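(* Let $(X,\alpha)$ be an algebra of the monad $\mathcal V_w$ on the category $\mathbf{TOP}_0$. Then $X$ is a topological cone with $+$ defined by $x+y=\alpha(\delta_x+\delta_y)$ and scalar multiplication defined by $r\cdot x=\alpha(r\delta_x)$, for $r\in\mathbb R_+$ and $x,y\in X$. Moreover, with respect to this cone structure on $X$, the structure map $\alpha\colon\mathcal V_wX\to X$ is linear and sends each $\mu\in\mathcal V_wX$ to a barycentre of $\mu$.
   Context: $\mathbb R_+=[0,\infty)$ and $\overline{\mathbb R}_+=[0,\infty]$, both with the Scott topology (proper nonempty opens are the sets of elements $>r$, $r\in\mathbb R_+$). $\mathbf{TOP}_0$ is the category of $T_0$ topological spaces and continuous maps. Valuations. A continuous valuation on a space $X$ with lattice of opens $\mathcal OX$ is a map $\mu\colon\mathcal OX\to\overline{\mathbb R}_+$ with $\mu(\emptyset)=0$, $\mu(U)\le\mu(V)$ if $U\subseteq V$, $\mu(U)+\mu(V)=\mu(U\cup V)+\mu(U\cap V)$, and $\mu(\bigcup_iU_i)=\sup_i\mu(U_i)$ for directed families of opens. $\delta_x(U)=1$ if $x\in U$, and $0$ otherwise. Linear combinations of valuations with coefficients in $\mathbb R_+$ are formed pointwise. $\mathcal V_wX$ is the set of all continuous valuations on $X$ with the weak topology, generated by the subbasic sets $[U>r]=\{\mu\mid\mu(U)>r\}$, $U\in\mathcal OX$, $r\in\mathbb R_+$; it is a cone under the pointwise operations. For continuous $h\colon X\to\overline{\mathbb R}_+$ (i.e. $h$ lower semi-continuous), $\int h\,d\mu=\int_0^\infty\mu(h^{-1}((r,\infty]))\,dr$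 (Riemann integral). The monad. $\mathcal V_w$ is an endofunctor with $\mathcal V_wf(\mu)(V)=\mu(f^{-1}(V))$; it is a monad with unit $\eta_X(x)=\delta_x$ and multiplication $m_X\colon\mathcal V_w\mathcal V_wX\to\mathcal V_wX$, $m_X(\varpi)(U)=\int_{\mu\in\mathcal V_wX}\mu(U)\,d\varpi$. An algebra of $\mathcal V_w$ on $\mathbf{TOP}_0$ (a $\mathcal V_w$-algebra) is a pair $(X,\alpha)$ of a $T_0$ space $X$ and a continuous map $\alpha\colon\mathcal V_wX\to X$ (the structure map) with $\alpha\circ\eta_X=\mathrm{id}_X$ and $\alpha\circ m_X=\alpha\circ\mathcal V_w\alpha$. Cones. A cone is a commutative monoid $(C,+,0)$ with a scalar multiplication $\mathbb R_+\times C\to C$ such that $r(x+y)=rx+ry$, $(r+s)x=rx+sx$, $(rs)x=r(sx)$, $1x=x$, $0x=0$, $r0=0$. A semitopological (resp. topological) cone is a cone with a $T_0$ topology making $+$ and scalar multiplication separately (resp. jointly) continuous. A map $f$ between cones is linear if $f(rx+sy)=rf(x)+sf(y)$ for all $r,s\in\mathbb R_+$; $\overline{\mathbb R}_+$ is a cone with $0\cdot\infty=0$. Barycentres. For a semitopological cone $C$ and a continuous valuation $\nu$ on $C$, a barycentre of $\nu$ is a point $b\in C$ such that $\Lambda(b)=\int\Lambda\,d\nu$ for every linear lower semi-continuous map $\Lambda\colon C\to\overline{\mathbb R}_+$. *)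

theory Defs
  imports "HOL-Analysis.Analysis"
begin

definition scott_ennreal :: "ennreal topology" where
  "scott_ennreal = topology (\<lambda>U. U = {} \<or> U = UNIV \<or> (\<exists>r::real. 0 \<le> r \<and> U = {x. ennreal r < x}))"

definition scott_Rplus :: "real topology" where
  "scott_Rplus = topology (\<lambda>U. U = {} \<or> U = {0..} \<or> (\<exists>r::real. 0 \<le> r \<and> U = {r<..}))"

lemma istopology_scott_ennreal:
  "istopology (\<lambda>U. U = {} \<or> U = UNIV \<or> (\<exists>r::real. 0 \<le> r \<and> U = {x. ennreal r < x}))"
  (is "istopology ?P")
  unfolding istopology_def
proof (intro conjI allI impI)
  fix S T assume ST: "?P S" "?P T"
  have max: "{x. ennreal r < x} \<inter> {x. ennreal s < x} = {x. ennreal (max r s) < x}" for r s :: real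
    by (cases "r \<le> s") (auto simp: max_def not_le intro: le_less_trans[OF ennreal_leI] dest: less_imp_le)
  show "?P (S \<inter> T)"
  proof (cases "S \<in> {{}, UNIV} \<or> T \<in> {{}, UNIV}")
    case True
    with ST show ?thesis by auto
  next
    case False
    with ST obtain r s :: real
      where "0 \<le> r" "0 \<le> s" "S = {x. ennreal r < x}" "T = {x. ennreal s < x}" by blast
    then have "0 \<le> max r s" "S \<inter> T = {x. ennreal (max r s) < x}"
      using max by auto
    then show ?thesis by blast
  qed
next
  fix K assume K: "\<forall>S\<in>K. ?P S"
  show "?P (\<Union>K)"
  proof (cases "UNIV \<in> K \<or> K \<subseteq> {{}}")
    case True
    then show ?thesis by auto
  next
    case False
    define R where "R = {r::real. 0 \<le> r \<and> {x. ennreal r < x} \<in> K}"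
    have ne: "R \<noteq> {}" using K False by (auto simp: R_def)
    have bdd: "bdd_below R" by (auto simp: R_def bdd_below_def)
    have nonneg: "0 \<le> Inf R" using ne by (auto intro!: cInf_greatest simp: R_def)
    have "\<Union>K = {x. ennreal (Inf R) < x}"
    proof (intro equalityI subsetI)
      fix x assume "x \<in> \<Union>K"
      then obtain S where S: "S \<in> K" "x \<in> S" by blast
      then obtain r where r: "0 \<le> r" "S = {x. ennreal r < x}" using K False by blast
      then have "r \<in> R" using S by (simp add: R_def)
      then have "ennreal (Inf R) \<le> ennreal r" by (intro ennreal_leI cInf_lower bdd)
      then show "x \<in> {x. ennreal (Inf R) < x}" using r S le_less_trans by blast
    next
      fix x assume x: "x \<in> {x. ennreal (Inf R) < x}"
      have "\<exists>r\<in>R. ennreal r < x"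
      proof (cases x)
        case (real t)
        then have "Inf R < t" using x nonneg by (simp add: ennreal_less_iff)
        then obtain r where "r \<in> R" "r < t" using cInf_lessD ne by blast
        then show ?thesis using real by (auto simp: R_def ennreal_less_iff)
      next
        case top
        then show ?thesis using ne by auto
      qed
      then show "x \<in> \<Union>K" by (auto simp: R_def)
    qed
    then show ?thesis using nonneg by blast
  qed
qed

lemma openin_scott_ennreal:
  "openin scott_ennreal U \<longleftrightarrow>
     U = {} \<or> U = UNIV \<or> (\<exists>r::real. 0 \<le> r \<and> U = {x. ennreal r < x})"
  unfolding scott_ennreal_def topology_inverse'[OF istopology_scott_ennreal] by (rule refl)

lemma topspace_scott_ennreal [simp]: "topspace scott_ennreal = UNIV"
  unfolding topspace_def openin_scott_ennreal by blast

lemma istopology_scott_Rplus: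
  "istopology (\<lambda>U. U = {} \<or> U = {0..} \<or> (\<exists>r::real. 0 \<le> r \<and> U = {r<..}))"
  (is "istopology ?P")
  unfolding istopology_def
proof (intro conjI allI impI)
  fix S T assume ST: "?P S" "?P T"
  have 1: "{r<..} \<inter> {s<..} = {max r s<..}" for r s :: real
    by auto
  have 2: "{0..} \<inter> {r<..} = {r<..}" "{r<..} \<inter> {0..} = {r<..}" if "0 \<le> r" for r :: real
    using that by auto
  from ST show "?P (S \<inter> T)"
    by (elim disjE exE conjE) (simp_all add: 1 2, metis max.coboundedI1)
next
  fix K assume K: "\<forall>S\<in>K. ?P S"
  show "?P (\<Union>K)"
  proof (cases "{0..} \<in> K \<or> K \<subseteq> {{}}")
    case True
    have "S \<subseteq> {0..}" if "S \<in> K" for S using K that by fastforce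
    with True show ?thesis by blast
  next
    case False
    define R where "R = {r::real. 0 \<le> r \<and> {r<..} \<in> K}"
    have ne: "R \<noteq> {}" using K False by (auto simp: R_def)
    have bdd: "bdd_below R" by (auto simp: R_def bdd_below_def)
    have nonneg: "0 \<le> Inf R" using ne by (auto intro!: cInf_greatest simp: R_def)
    have "\<Union>K = {Inf R<..}"
    proof (intro equalityI subsetI)
      fix x assume "x \<in> \<Union>K"
      then obtain S where S: "S \<in> K" "x \<in> S" by blast
      then obtain r where r: "0 \<le> r" "S = {r<..}" using K False by blast
      then have "Inf R \<le> r" using S by (intro cInf_lower bdd) (simp add: R_def)
      then show "x \<in> {Inf R<..}" using r S by auto
    next
      fix x assume "x \<in> {Inf R<..}"
      then obtain r where "r \<in> R" "r < x" using cInf_lessD ne by auto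
      then show "x \<in> \<Union>K" by (auto simp: R_def)
    qed
    then show ?thesis using nonneg by blast
  qed
qed

lemma openin_scott_Rplus:
  "openin scott_Rplus U \<longleftrightarrow> U = {} \<or> U = {0..} \<or> (\<exists>r::real. 0 \<le> r \<and> U = {r<..})"
  unfolding scott_Rplus_def topology_inverse'[OF istopology_scott_Rplus] by (rule refl)

lemma topspace_scott_Rplus [simp]: "topspace scott_Rplus = {0..}"
  unfolding topspace_def openin_scott_Rplus by force

text \<open>
  A valuation is only defined on the open sets of \<open>X\<close>. It is represented by a total
  function on sets, made unique by the convention that it is 0 on sets that are not
  open; this convention is preserved by pointwise sums and multiples.
\<close>

definition continuous_valuation :: "'a topology \<Rightarrow> ('a set \<Rightarrow> ennreal) \<Rightarrow> bool" where
  "continuous_valuation X \<mu> \<longleftrightarrow>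
     (\<forall>U. \<not> openin X U \<longrightarrow> \<mu> U = 0) \<and>
     \<mu> {} = 0 \<and>
     (\<forall>U V. openin X U \<and> openin X V \<and> U \<subseteq> V \<longrightarrow> \<mu> U \<le> \<mu> V) \<and>
     (\<forall>U V. openin X U \<and> openin X V \<longrightarrow> \<mu> U + \<mu> V = \<mu> (U \<union> V) + \<mu> (U \<inter> V)) \<and>
     (\<forall>D. D \<noteq> {} \<and> (\<forall>U\<in>D. openin X U) \<and> (\<forall>U\<in>D. \<forall>V\<in>D. \<exists>W\<in>D. U \<subseteq> W \<and> V \<subseteq> W)
        \<longrightarrow> \<mu> (\<Union>D) = (SUP U\<in>D. \<mu> U))"

definition dirac :: "'a topology \<Rightarrow> 'a \<Rightarrow> 'a set \<Rightarrow> ennreal" where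
  "dirac X x = (\<lambda>U. if openin X U \<and> x \<in> U then 1 else 0)"

definition val_add :: "('a set \<Rightarrow> ennreal) \<Rightarrow> ('a set \<Rightarrow> ennreal) \<Rightarrow> 'a set \<Rightarrow> ennreal" where
  "val_add \<mu> \<nu> = (\<lambda>U. \<mu> U + \<nu> U)"

definition val_scale :: "real \<Rightarrow> ('a set \<Rightarrow> ennreal) \<Rightarrow> 'a set \<Rightarrow> ennreal" where
  "val_scale r \<mu> = (\<lambda>U. ennreal r * \<mu> U)"

text \<open>
  The subbasic sets alone do not cover the zero valuation, so the whole space is added
  to the generating family.
\<close>

definition Vw :: "'a topology \<Rightarrow> ('a set \<Rightarrow> ennreal) topology" where
  "Vw X = topology_generated_by
     (insert {\<mu>. continuous_valuation X \<mu>}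
        {{\<mu>. continuous_valuation X \<mu> \<and> ennreal r < \<mu> U} | U r. openin X U \<and> 0 \<le> r})"

lemma topspace_Vw [simp]: "topspace (Vw X) = {\<mu>. continuous_valuation X \<mu>}"
  unfolding Vw_def topology_generated_by_topspace by auto

text \<open>
  The integrand is a nonincreasing function of \<open>r\<close> with values in \<open>[0, \<infinity>]\<close>, so that its
  improper Riemann integral over \<open>[0, \<infinity>)\<close> is its Lebesgue integral.
\<close>

definition val_integral :: "'a topology \<Rightarrow> ('a \<Rightarrow> ennreal) \<Rightarrow> ('a set \<Rightarrow> ennreal) \<Rightarrow> ennreal" where
  "val_integral X h \<mu> = (\<integral>\<^sup>+ r\<in>{0..}. \<mu> {x \<in> topspace X. ennreal r < h x} \<partial>lborel)"

definition Vw_map ::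
  "'a topology \<Rightarrow> 'b topology \<Rightarrow> ('a \<Rightarrow> 'b) \<Rightarrow> ('a set \<Rightarrow> ennreal) \<Rightarrow> 'b set \<Rightarrow> ennreal" where
  "Vw_map X Y f \<mu> = (\<lambda>V. if openin Y V then \<mu> {x \<in> topspace X. f x \<in> V} else 0)"

definition Vw_mult :: "'a topology \<Rightarrow> (('a set \<Rightarrow> ennreal) set \<Rightarrow> ennreal) \<Rightarrow> 'a set \<Rightarrow> ennreal" where
  "Vw_mult X \<omega> = (\<lambda>U. if openin X U then val_integral (Vw X) (\<lambda>\<mu>. \<mu> U) \<omega> else 0)"

definition Vw_algebra :: "'a topology \<Rightarrow> (('a set \<Rightarrow> ennreal) \<Rightarrow> 'a) \<Rightarrow> bool" where
  "Vw_algebra X \<alpha> \<longleftrightarrow>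
     t0_space X \<and>
     continuous_map (Vw X) X \<alpha> \<and>
     (\<forall>x\<in>topspace X. \<alpha> (dirac X x) = x) \<and>
     (\<forall>\<omega>\<in>topspace (Vw (Vw X)). \<alpha> (Vw_mult X \<omega>) = \<alpha> (Vw_map (Vw X) X \<alpha> \<omega>))"

locale cone_on =
  fixes C :: "'c set"
    and add :: "'c \<Rightarrow> 'c \<Rightarrow> 'c"
    and zero :: 'c
    and smul :: "real \<Rightarrow> 'c \<Rightarrow> 'c"
  assumes add_closed: "x \<in> C \<Longrightarrow> y \<in> C \<Longrightarrow> add x y \<in> C"
    and zero_closed: "zero \<in> C"
    and smul_closed: "0 \<le> r \<Longrightarrow> x \<in> C \<Longrightarrow> smul r x \<in> C"
    and add_assoc: "x \<in> C \<Longrightarrow> y \<in> C \<Longrightarrow> z \<in> C \<Longrightarrow> add (add x y) z = add x (add y z)"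
    and add_commute: "x \<in> C \<Longrightarrow> y \<in> C \<Longrightarrow> add x y = add y x"
    and add_zero: "x \<in> C \<Longrightarrow> add x zero = x"
    and smul_add: "0 \<le> r \<Longrightarrow> x \<in> C \<Longrightarrow> y \<in> C \<Longrightarrow> smul r (add x y) = add (smul r x) (smul r y)"
    and add_smul: "0 \<le> r \<Longrightarrow> 0 \<le> s \<Longrightarrow> x \<in> C \<Longrightarrow> smul (r + s) x = add (smul r x) (smul s x)"
    and mult_smul: "0 \<le> r \<Longrightarrow> 0 \<le> s \<Longrightarrow> x \<in> C \<Longrightarrow> smul (r * s) x = smul r (smul s x)"
    and one_smul: "x \<in> C \<Longrightarrow> smul 1 x = x"
    and zero_smul: "x \<in> C \<Longrightarrow> smul 0 x = zero"
    and smul_zero: "0 \<le> r \<Longrightarrow> smul r zero = zero"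

locale topological_cone = cone_on "topspace X" add zero smul
  for X :: "'c topology" and add zero smul +
  assumes t0: "t0_space X"
    and continuous_add: "continuous_map (prod_topology X X) X (\<lambda>(x, y). add x y)"
    and continuous_smul: "continuous_map (prod_topology scott_Rplus X) X (\<lambda>(r, x). smul r x)"

definition linear_between ::
  "'c set \<Rightarrow> ('c \<Rightarrow> 'c \<Rightarrow> 'c) \<Rightarrow> (real \<Rightarrow> 'c \<Rightarrow> 'c) \<Rightarrow>
   'd set \<Rightarrow> ('d \<Rightarrow> 'd \<Rightarrow> 'd) \<Rightarrow> (real \<Rightarrow> 'd \<Rightarrow> 'd) \<Rightarrow> ('c \<Rightarrow> 'd) \<Rightarrow> bool" where
  "linear_between C add smul D add' smul' f \<longleftrightarrow>
     f ` C \<subseteq> D \<and>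
     (\<forall>r s x y. 0 \<le> r \<and> 0 \<le> s \<and> x \<in> C \<and> y \<in> C \<longrightarrow>
        f (add (smul r x) (smul s y)) = add' (smul' r (f x)) (smul' s (f y)))"

definition is_barycentre ::
  "'c topology \<Rightarrow> ('c \<Rightarrow> 'c \<Rightarrow> 'c) \<Rightarrow> (real \<Rightarrow> 'c \<Rightarrow> 'c) \<Rightarrow> ('c set \<Rightarrow> ennreal) \<Rightarrow> 'c \<Rightarrow> bool" where
  "is_barycentre X add smul \<nu> b \<longleftrightarrow>
     b \<in> topspace X \<and>
     (\<forall>\<Lambda>. linear_between (topspace X) add smul UNIV (+) (\<lambda>r t. ennreal r * t) \<Lambda> \<and>
           continuous_map X scott_ennreal \<Lambda> \<longrightarrow>
           \<Lambda> b = val_integral X \<Lambda> \<nu>)"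

definition alg_add :: "'a topology \<Rightarrow> (('a set \<Rightarrow> ennreal) \<Rightarrow> 'a) \<Rightarrow> 'a \<Rightarrow> 'a \<Rightarrow> 'a" where
  "alg_add X \<alpha> x y = \<alpha> (val_add (dirac X x) (dirac X y))"

definition alg_smul :: "'a topology \<Rightarrow> (('a set \<Rightarrow> ennreal) \<Rightarrow> 'a) \<Rightarrow> real \<Rightarrow> 'a \<Rightarrow> 'a" where
  "alg_smul X \<alpha> r x = \<alpha> (val_scale r (dirac X x))"

end

theory Submission
  imports Defs
begin

text \<open>
  The associativity law of the algebra at \<open>r \<delta>\<^sub>\<mu> + s \<delta>\<^sub>\<nu>\<close> says that \<open>\<alpha>\<close> turns the cone operations
  of valuations into those of \<open>X\<close>; being surjective, it transports the cone axioms. For a linear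
  lower semicontinuous \<open>\<Lambda>\<close>, the barycentre equation is the Schroeder-Simpson theorem for the
  functional \<open>\<phi> = \<Lambda> \<circ> \<alpha>\<close>: \<open>\<phi> \<mu> = \<integral> h d\<mu>\<close> with \<open>h x = \<phi> \<delta>\<^sub>x\<close>.

  For \<open>\<ge>\<close>, a weak neighbourhood of \<open>\<delta>\<^sub>x\<close> on which \<open>\<phi> > a\<close> gives an open \<open>V\<close> containing \<open>x\<close> with
  \<open>a \<mu>(V) \<le> \<phi> \<mu>\<close> for all \<open>\<mu>\<close>. This property of \<open>V\<close> passes to binary unions, by splitting \<open>\<mu>\<close> into
  its parts on \<open>V\<close> and off \<open>V\<close>, and to directed unions, hence to \<open>{h > a}\<close>; slicing \<open>\<mu>\<close> along the
  superlevel sets of \<open>h\<close> bounds the Riemann sums of \<open>\<integral> h d\<mu>\<close> by \<open>\<phi> \<mu>\<close>. For \<open>\<le>\<close>, every weak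
  neighbourhood of a bounded \<open>\<mu>\<close> contains some \<open>\<theta>\<close> with \<open>\<phi> \<theta> \<le> \<integral> h d\<mu> + \<epsilon>\<close>, obtained by cutting
  \<open>\<mu>\<close> along finitely many open sets and concentrating each piece at a point of small density.
\<close>

subsection \<open>Continuous valuations\<close>

lemma continuous_valuation_nonopen: "continuous_valuation X \<mu> \<Longrightarrow> \<not> openin X U \<Longrightarrow> \<mu> U = 0"
  unfolding continuous_valuation_def by blast

lemma continuous_valuation_empty: "continuous_valuation X \<mu> \<Longrightarrow> \<mu> {} = 0"
  unfolding continuous_valuation_def by blast

lemma continuous_valuation_mono:
  "continuous_valuation X \<mu> \<Longrightarrow> openin X U \<Longrightarrow> openin X V \<Longrightarrow> U \<subseteq> V \<Longrightarrow> \<mu> U \<le> \<mu> V"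
  unfolding continuous_valuation_def by blast

lemma continuous_valuation_modular:
  "continuous_valuation X \<mu> \<Longrightarrow> openin X U \<Longrightarrow> openin X V \<Longrightarrow>
    \<mu> U + \<mu> V = \<mu> (U \<union> V) + \<mu> (U \<inter> V)"
  unfolding continuous_valuation_def by blast

lemma continuous_valuation_Union:
  assumes "continuous_valuation X \<mu>" "D \<noteq> {}" "\<And>U. U \<in> D \<Longrightarrow> openin X U"
    and "\<And>U V. U \<in> D \<Longrightarrow> V \<in> D \<Longrightarrow> \<exists>W\<in>D. U \<subseteq> W \<and> V \<subseteq> W"
  shows "\<mu> (\<Union>D) = (SUP U\<in>D. \<mu> U)"
proof -
  have "D \<noteq> {} \<and> (\<forall>U\<in>D. openin X U) \<and> (\<forall>U\<in>D. \<forall>V\<in>D. \<exists>W\<in>D. U \<subseteq> W \<and> V \<subseteq> W)"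
    using assms(2-4) by simp
  then show ?thesis
    using assms(1) unfolding continuous_valuation_def by presburger
qed

lemma continuous_valuation_Un_less_top:
  assumes "continuous_valuation X \<mu>" "openin X U" "openin X V" "\<mu> U < \<infinity>" "\<mu> V < \<infinity>"
  shows "\<mu> (U \<union> V) < \<infinity>"
proof -
  have "\<mu> (U \<union> V) \<le> \<mu> U + \<mu> V"
    using continuous_valuation_modular[OF assms(1-3)] by simp
  also have "\<dots> < \<infinity>"
    using assms by simp
  finally show ?thesis .
qed

lemma continuous_valuation_add:
  assumes "continuous_valuation X \<mu>" "continuous_valuation X \<nu>"
  shows "continuous_valuation X (val_add \<mu> \<nu>)"
  unfolding continuous_valuation_def val_add_def
proof (intro conjI allI impI)
  fix U V assume "openin X U \<and> openin X V"
  then have "\<mu> U + \<mu> V = \<mu> (U \<union> V) + \<mu> (U \<inter> V)" "\<nu> U + \<nu> V = \<nu> (U \<union> V) + \<nu> (U \<inter> V)"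
    using assms continuous_valuation_modular by blast+
  then show "\<mu> U + \<nu> U + (\<mu> V + \<nu> V) = \<mu> (U \<union> V) + \<nu> (U \<union> V) + (\<mu> (U \<inter> V) + \<nu> (U \<inter> V))"
    by (metis (no_types, lifting) add.assoc add.left_commute)
next
  fix D assume D: "D \<noteq> {} \<and> (\<forall>U\<in>D. openin X U) \<and> (\<forall>U\<in>D. \<forall>V\<in>D. \<exists>W\<in>D. U \<subseteq> W \<and> V \<subseteq> W)"
  \<comment> \<open>A supremum of sums splits because the family is directed: a common upper bound
    \<open>W\<close> of \<open>U\<close> and \<open>V\<close> dominates the mixed term
    \<open>\<mu> U + \<nu> V\<close>.\<close>
  have "(SUP U\<in>D. \<mu> U + \<nu> U) = (SUP U\<in>D. \<mu> U) + (SUP U\<in>D. \<nu> U)"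
  proof (rule SUP_add_directed_ennreal)
    fix U V assume "U \<in> D" "V \<in> D"
    with D obtain W where "W \<in> D" "U \<subseteq> W" "V \<subseteq> W" by blast
    with D \<open>U \<in> D\<close> \<open>V \<in> D\<close> show "\<exists>W\<in>D. \<mu> U + \<nu> V \<le> \<mu> W + \<nu> W"
      by (intro bexI[of _ W] add_mono continuous_valuation_mono[OF assms(1)]
          continuous_valuation_mono[OF assms(2)]) auto
  qed
  then show "\<mu> (\<Union>D) + \<nu> (\<Union>D) = (SUP U\<in>D. \<mu> U + \<nu> U)"
    using D by (simp add: continuous_valuation_Union[OF assms(1)] continuous_valuation_Union[OF assms(2)])
next
  fix U V assume "openin X U \<and> openin X V \<and> U \<subseteq> V"
  then show "\<mu> U + \<nu> U \<le> \<mu> V + \<nu> V"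
    using assms by (meson add_mono continuous_valuation_mono)
next
  show "\<mu> {} + \<nu> {} = 0"
    by (simp add: continuous_valuation_empty[OF assms(1)] continuous_valuation_empty[OF assms(2)])
next
  fix U assume "\<not> openin X U"
  then show "\<mu> U + \<nu> U = 0"
    by (simp add: continuous_valuation_nonopen[OF assms(1)] continuous_valuation_nonopen[OF assms(2)])
qed

lemma continuous_valuation_scale:
  assumes "continuous_valuation X \<mu>"
  shows "continuous_valuation X (val_scale r \<mu>)"
  unfolding continuous_valuation_def val_scale_def
proof (intro conjI allI impI)
  fix U V assume "openin X U \<and> openin X V"
  then show "ennreal r * \<mu> U + ennreal r * \<mu> V = ennreal r * \<mu> (U \<union> V) + ennreal r * \<mu> (U \<inter> V)"
    using continuous_valuation_modular[OF assms, of U V] by (metis distrib_left)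
next
  fix D assume "D \<noteq> {} \<and> (\<forall>U\<in>D. openin X U) \<and> (\<forall>U\<in>D. \<forall>V\<in>D. \<exists>W\<in>D. U \<subseteq> W \<and> V \<subseteq> W)"
  then have "\<mu> (\<Union>D) = (SUP U\<in>D. \<mu> U)"
    by (intro continuous_valuation_Union[OF assms]) auto
  then show "ennreal r * \<mu> (\<Union>D) = (SUP U\<in>D. ennreal r * \<mu> U)"
    by (simp add: SUP_mult_left_ennreal)
next
  fix U V assume "openin X U \<and> openin X V \<and> U \<subseteq> V"
  then show "ennreal r * \<mu> U \<le> ennreal r * \<mu> V"
    using assms by (meson mult_left_mono zero_le continuous_valuation_mono)
next
  show "ennreal r * \<mu> {} = 0"
    by (simp add: continuous_valuation_empty[OF assms])
next
  fix U assume "\<not> openin X U"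
  then show "ennreal r * \<mu> U = 0"
    by (simp add: continuous_valuation_nonopen[OF assms])
qed

lemma continuous_valuation_zero: "continuous_valuation X (\<lambda>U. 0)"
  unfolding continuous_valuation_def by auto

lemma continuous_valuation_dirac: "continuous_valuation X (dirac X x)"
  unfolding continuous_valuation_def
proof (intro conjI allI impI)
  fix D assume D: "D \<noteq> {} \<and> (\<forall>U\<in>D. openin X U) \<and> (\<forall>U\<in>D. \<forall>V\<in>D. \<exists>W\<in>D. U \<subseteq> W \<and> V \<subseteq> W)"
  show "dirac X x (\<Union>D) = (SUP U\<in>D. dirac X x U)"
  proof (cases "x \<in> \<Union>D")
    case True
    then obtain U where U: "U \<in> D" "x \<in> U" by blast
    have "(SUP U\<in>D. dirac X x U) = 1"
    proof (rule antisym)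
      show "(SUP U\<in>D. dirac X x U) \<le> 1"
        by (rule SUP_least) (simp add: dirac_def)
      show "1 \<le> (SUP U\<in>D. dirac X x U)"
        by (rule SUP_upper2[OF U(1)]) (use U D in \<open>simp add: dirac_def\<close>)
    qed
    then show ?thesis
      using D True by (auto simp: dirac_def)
  next
    case False
    then have "(SUP U\<in>D. dirac X x U) = (SUP U\<in>D. 0)"
      by (intro SUP_cong) (auto simp: dirac_def)
    then show ?thesis
      using D False by (auto simp: dirac_def)
  qed
qed (auto simp: dirac_def)

section \<open>Splitting a valuation along an open set\<close>

definition val_restrict :: "'a topology \<Rightarrow> 'a set \<Rightarrow> ('a set \<Rightarrow> ennreal) \<Rightarrow> 'a set \<Rightarrow> ennreal" where
  "val_restrict X V \<mu> = (\<lambda>U. if openin X U then \<mu> (V \<inter> U) else 0)"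

text \<open>
  Off \<open>V\<close>, the valuation is given by the increments \<open>\<mu> (U \<union> V) - \<mu> V\<close>; truncated
  subtraction makes this meaningful only when \<open>\<mu> V\<close> is finite.
\<close>

definition val_corestrict :: "'a topology \<Rightarrow> 'a set \<Rightarrow> ('a set \<Rightarrow> ennreal) \<Rightarrow> 'a set \<Rightarrow> ennreal" where
  "val_corestrict X V \<mu> = (\<lambda>U. if openin X U then \<mu> (U \<union> V) - \<mu> V else 0)"

lemma continuous_valuation_restrict:
  assumes \<mu>: "continuous_valuation X \<mu>" and V: "openin X V"
  shows "continuous_valuation X (val_restrict X V \<mu>)"
  unfolding continuous_valuation_def
proof (intro conjI allI impI)
  fix U W assume "openin X U \<and> openin X W"
  then show "val_restrict X V \<mu> U + val_restrict X V \<mu> W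
      = val_restrict X V \<mu> (U \<union> W) + val_restrict X V \<mu> (U \<inter> W)"
    using continuous_valuation_modular[OF \<mu>, of "V \<inter> U" "V \<inter> W"] V
    by (simp add: val_restrict_def openin_Int openin_Un Int_Un_distrib Int_ac)
next
  fix D assume D: "D \<noteq> {} \<and> (\<forall>U\<in>D. openin X U) \<and> (\<forall>U\<in>D. \<forall>V\<in>D. \<exists>W\<in>D. U \<subseteq> W \<and> V \<subseteq> W)"
  have "\<mu> (\<Union>((\<inter>) V ` D)) = (SUP U\<in>(\<inter>) V ` D. \<mu> U)"
  proof (rule continuous_valuation_Union[OF \<mu>])
    fix A B assume "A \<in> (\<inter>) V ` D" "B \<in> (\<inter>) V ` D"
    then obtain A' B' where AB: "A' \<in> D" "B' \<in> D" "A = V \<inter> A'" "B = V \<inter> B'" by blast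
    with D obtain W where "W \<in> D" "A' \<subseteq> W" "B' \<subseteq> W" by blast
    with AB show "\<exists>W\<in>(\<inter>) V ` D. A \<subseteq> W \<and> B \<subseteq> W" by blast
  qed (use D V in auto)
  also have "\<Union>((\<inter>) V ` D) = V \<inter> \<Union>D" by blast
  finally show "val_restrict X V \<mu> (\<Union>D) = (SUP U\<in>D. val_restrict X V \<mu> U)"
    using D by (simp add: val_restrict_def image_image openin_Union)
next
  fix U W assume "openin X U \<and> openin X W \<and> U \<subseteq> W"
  then show "val_restrict X V \<mu> U \<le> val_restrict X V \<mu> W"
    using continuous_valuation_mono[OF \<mu>, of "V \<inter> U" "V \<inter> W"] V
    by (simp add: val_restrict_def openin_Int le_infI2)
qed (simp_all add: val_restrict_def continuous_valuation_empty[OF \<mu>])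

text \<open>Adding \<open>\<mu> V\<close> back to an increment gives
  \<open>\<mu> (A \<union> V)\<close>, so modularity and continuity come from those of
  \<open>\<mu>\<close> on the sets \<open>A \<union> V\<close>. Finiteness of \<open>\<mu> V\<close>
  permits the final cancellation and the exchange of difference and supremum.\<close>

lemma continuous_valuation_corestrict:
  assumes \<mu>: "continuous_valuation X \<mu>" and V: "openin X V" and fin: "\<mu> V < \<infinity>"
  shows "continuous_valuation X (val_corestrict X V \<mu>)"
  unfolding continuous_valuation_def
proof (intro conjI allI impI)
  fix U W assume UW: "openin X U \<and> openin X W"
  let ?c = "\<lambda>A. val_corestrict X V \<mu> A"
  have c: "?c A + \<mu> V = \<mu> (A \<union> V)" if "openin X A" for A
    using that V continuous_valuation_mono[OF \<mu>, of V "A \<union> V"]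
    by (simp add: val_corestrict_def diff_add_self_ennreal openin_Un)
  have "(U \<union> V) \<union> (W \<union> V) = U \<union> W \<union> V" "(U \<union> V) \<inter> (W \<union> V) = (U \<inter> W) \<union> V"
    by auto
  then have "\<mu> (U \<union> V) + \<mu> (W \<union> V) = \<mu> (U \<union> W \<union> V) + \<mu> ((U \<inter> W) \<union> V)"
    using continuous_valuation_modular[OF \<mu>, of "U \<union> V" "W \<union> V"] UW V
    by (simp add: openin_Un)
  then have "(?c U + ?c W) + (\<mu> V + \<mu> V) = (?c (U \<union> W) + ?c (U \<inter> W)) + (\<mu> V + \<mu> V)"
    using UW by (simp add: c[symmetric] openin_Un openin_Int add_ac)
  then show "?c U + ?c W = ?c (U \<union> W) + ?c (U \<inter> W)"
    using fin by (auto simp: add.commute[of _ "\<mu> V + \<mu> V"] ennreal_add_left_cancel)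
next
  fix D assume D: "D \<noteq> {} \<and> (\<forall>U\<in>D. openin X U) \<and> (\<forall>U\<in>D. \<forall>V\<in>D. \<exists>W\<in>D. U \<subseteq> W \<and> V \<subseteq> W)"
  have "\<mu> (\<Union>((\<lambda>U. U \<union> V) ` D)) = (SUP U\<in>(\<lambda>U. U \<union> V) ` D. \<mu> U)"
  proof (rule continuous_valuation_Union[OF \<mu>])
    fix A B assume "A \<in> (\<lambda>U. U \<union> V) ` D" "B \<in> (\<lambda>U. U \<union> V) ` D"
    then obtain A' B' where AB: "A' \<in> D" "B' \<in> D" "A = A' \<union> V" "B = B' \<union> V" by blast
    with D obtain W where "W \<in> D" "A' \<subseteq> W" "B' \<subseteq> W" by blast
    with AB show "\<exists>W\<in>(\<lambda>U. U \<union> V) ` D. A \<subseteq> W \<and> B \<subseteq> W" by blast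
  qed (use D V in auto)
  also have "\<Union>((\<lambda>U. U \<union> V) ` D) = \<Union>D \<union> V" using D by blast
  finally show "val_corestrict X V \<mu> (\<Union>D) = (SUP U\<in>D. val_corestrict X V \<mu> U)"
    using D fin by (simp add: val_corestrict_def image_image openin_Union SUP_diff_ennreal)
next
  fix U W assume UW: "openin X U \<and> openin X W \<and> U \<subseteq> W"
  then have "\<mu> (U \<union> V) \<le> \<mu> (W \<union> V)"
    using V by (intro continuous_valuation_mono[OF \<mu>] openin_Un) auto
  then show "val_corestrict X V \<mu> U \<le> val_corestrict X V \<mu> W"
    using UW by (simp add: val_corestrict_def ennreal_minus_mono)
qed (use fin in \<open>simp_all add: val_corestrict_def\<close>)

text \<open>On open sets this is modularity of \<open>\<mu>\<close> at \<open>U\<close> and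
  \<open>V\<close> with the finite mass \<open>\<mu> V\<close> cancelled; on all other sets both
  sides take the default value 0.\<close>

lemma val_add_restrict_corestrict:
  assumes \<mu>: "continuous_valuation X \<mu>" and V: "openin X V" and fin: "\<mu> V < \<infinity>"
  shows "val_add (val_restrict X V \<mu>) (val_corestrict X V \<mu>) = \<mu>"
proof
  fix U
  show "val_add (val_restrict X V \<mu>) (val_corestrict X V \<mu>) U = \<mu> U"
  proof (cases "openin X U")
    case True
    have "\<mu> (V \<inter> U) + (\<mu> (U \<union> V) - \<mu> V) + \<mu> V = \<mu> U + \<mu> V"
      using continuous_valuation_modular[OF \<mu> True V] True V
        continuous_valuation_mono[OF \<mu>, of V "U \<union> V"]
      by (simp add: add.assoc diff_add_self_ennreal Int_commute add.commute openin_Un)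
    then show ?thesis
      using True fin by (auto simp: val_add_def val_restrict_def val_corestrict_def
          add.commute[of _ "\<mu> V"] ennreal_add_left_cancel)
  qed (simp add: val_add_def val_restrict_def val_corestrict_def continuous_valuation_nonopen[OF \<mu>])
qed

subsection \<open>The weak topology\<close>

lemma openin_Vw_subbasic:
  assumes "openin X U" "0 \<le> r"
  shows "openin (Vw X) {\<mu>. continuous_valuation X \<mu> \<and> ennreal r < \<mu> U}"
  unfolding Vw_def by (rule topology_generated_by_Basis) (use assms in blast)

lemma continuous_map_Vw:
  assumes "\<And>x. x \<in> topspace T \<Longrightarrow> continuous_valuation X (f x)"
    and "\<And>U r. openin X U \<Longrightarrow> 0 \<le> r \<Longrightarrow> openin T {x \<in> topspace T. ennreal r < f x U}"
  shows "continuous_map T (Vw X) f"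
  unfolding Vw_def
proof (rule continuous_on_generated_topo)
  show "f ` topspace T \<subseteq> \<Union> (insert {\<mu>. continuous_valuation X \<mu>}
        {{\<mu>. continuous_valuation X \<mu> \<and> ennreal r < \<mu> U} | U r. openin X U \<and> 0 \<le> r})"
    using assms(1) by blast
  fix S assume "S \<in> insert {\<mu>. continuous_valuation X \<mu>}
        {{\<mu>. continuous_valuation X \<mu> \<and> ennreal r < \<mu> U} | U r. openin X U \<and> 0 \<le> r}"
  then consider "S = {\<mu>. continuous_valuation X \<mu>}"
    | U r where "openin X U" "0 \<le> r" "S = {\<mu>. continuous_valuation X \<mu> \<and> ennreal r < \<mu> U}"
    by blast
  then show "openin T (f -` S \<inter> topspace T)"
  proof cases
    case 1
    then have "f -` S \<inter> topspace T = topspace T" using assms(1) by blast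
    then show ?thesis by simp
  next
    case 2
    then have "f -` S \<inter> topspace T = {x \<in> topspace T. ennreal r < f x U}" using assms(1) by blast
    then show ?thesis using assms(2) 2 by simp
  qed
qed

lemma continuous_map_dirac: "continuous_map X (Vw X) (dirac X)"
proof (rule continuous_map_Vw)
  fix U and r :: real assume U: "openin X U"
  then have "{x \<in> topspace X. ennreal r < dirac X x U} = (if ennreal r < 1 then U else {})"
    using openin_subset[OF U] by (auto simp: dirac_def)
  then show "openin X {x \<in> topspace X. ennreal r < dirac X x U}"
    using U by simp
qed (rule continuous_valuation_dirac)

text \<open>Induction on the generation of the topology, for the statement that finitely many
  constraints met by \<open>\<mu>\<close> force membership. An intersection merges two sets of
  constraints, a union keeps those of one member, and the generator consisting of all valuations has
  none.\<close>

lemma Vw_neighbourhood: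
  assumes "openin (Vw X) \<O>" "\<mu> \<in> \<O>"
  obtains S where "finite S" "\<And>U r. (U, r) \<in> S \<Longrightarrow> openin X U \<and> 0 \<le> r \<and> ennreal r < \<mu> U"
    "\<And>\<nu>. continuous_valuation X \<nu> \<Longrightarrow> (\<And>U r. (U, r) \<in> S \<Longrightarrow> ennreal r < \<nu> U) \<Longrightarrow> \<nu> \<in> \<O>"
proof -
  define P where "P \<nu> p \<longleftrightarrow> openin X (fst p) \<and> 0 \<le> snd p \<and> ennreal (snd p) < \<nu> (fst p)"
    for \<nu> and p :: "'a set \<times> real"
  define N where "N S A \<longleftrightarrow> finite S \<and> (\<forall>p\<in>S. P \<mu> p) \<and>
      (\<forall>\<nu>. continuous_valuation X \<nu> \<longrightarrow> (\<forall>p\<in>S. P \<nu> p) \<longrightarrow> \<nu> \<in> A)" for S A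
  have "generate_topology_on (insert {\<mu>. continuous_valuation X \<mu>}
        {{\<mu>. continuous_valuation X \<mu> \<and> ennreal r < \<mu> U} | U r. openin X U \<and> 0 \<le> r}) \<O>"
    using assms(1) unfolding Vw_def by (rule openin_topology_generated_by)
  then have "\<mu> \<in> \<O> \<longrightarrow> (\<exists>S. N S \<O>)"
  proof induction
    case (Int A B)
    show ?case
    proof
      assume "\<mu> \<in> A \<inter> B"
      with Int obtain SA SB where "N SA A" "N SB B" by auto
      then have "N (SA \<union> SB) (A \<inter> B)"
        unfolding N_def by (simp add: ball_Un)
      then show "\<exists>S. N S (A \<inter> B)" ..
    qed
  next
    case (UN K)
    show ?case
    proof
      assume "\<mu> \<in> \<Union>K"
      then obtain A where A: "A \<in> K" "\<mu> \<in> A" by blast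
      with UN obtain S where "N S A" by blast
      with A have "N S (\<Union>K)" unfolding N_def by auto
      then show "\<exists>S. N S (\<Union>K)" ..
    qed
  next
    case (Basis A)
    then consider "A = {\<mu>. continuous_valuation X \<mu>}"
      | U r where "openin X U" "0 \<le> r" "A = {\<mu>. continuous_valuation X \<mu> \<and> ennreal r < \<mu> U}"
      by blast
    then show ?case
    proof cases
      case 1
      then have "N {} A" unfolding N_def by simp
      then show ?thesis by blast
    next
      case 2
      then have "\<mu> \<in> A \<longrightarrow> N {(U, r)} A" unfolding N_def P_def by simp
      then show ?thesis by blast
    qed
  qed simp
  with assms(2) obtain S where S: "N S \<O>" by blast
  show thesis
  proof (rule that[of S])
    show "finite S"
      using S by (simp add: N_def)
    show SP: "openin X U \<and> 0 \<le> r \<and> ennreal r < \<mu> U" if "(U, r) \<in> S" for U r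
      using S that unfolding N_def P_def by fastforce
    fix \<nu> assume "continuous_valuation X \<nu>" and *: "\<And>U r. (U, r) \<in> S \<Longrightarrow> ennreal r < \<nu> U"
    moreover have "P \<nu> p" if "p \<in> S" for p
      using SP[of "fst p" "snd p"] *[of "fst p" "snd p"] that by (simp add: P_def)
    ultimately show "\<nu> \<in> \<O>"
      using S by (simp add: N_def)
  qed
qed

subsection \<open>Integration against a valuation\<close>

text \<open>The set where an antitone function exceeds a given value is closed downwards, hence an
  interval.\<close>

lemma borel_measurable_antimono_ennreal:
  fixes f :: "real \<Rightarrow> ennreal"
  assumes "\<And>s t. s \<le> t \<Longrightarrow> f t \<le> f s"
  shows "f \<in> borel_measurable borel"
proof (rule borel_measurableI_greater)
  fix y :: ennreal
  have "is_interval {t. y < f t}"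
    unfolding is_interval_1 using assms by (auto intro: less_le_trans)
  then have "{t. y < f t} \<in> sets borel"
    by (rule real_interval_borel_measurable)
  then show "{x \<in> space borel. y < f x} \<in> sets borel"
    by simp
qed

text \<open>For negative \<open>t\<close> the term \<open>ennreal t\<close> is 0, so the set is that
  of level 0; this is why openness can be asked at every real level.\<close>

definition superlevel :: "'a topology \<Rightarrow> ('a \<Rightarrow> ennreal) \<Rightarrow> real \<Rightarrow> 'a set" where
  "superlevel X h t = {x \<in> topspace X. ennreal t < h x}"

lemma superlevel_antimono: "s \<le> t \<Longrightarrow> superlevel X h t \<subseteq> superlevel X h s"
  by (auto simp: superlevel_def intro: le_less_trans[OF ennreal_leI])

lemma val_integral_superlevel:
  "val_integral X h \<mu> = (\<integral>\<^sup>+ t\<in>{0..}. \<mu> (superlevel X h t) \<partial>lborel)"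
  by (simp add: val_integral_def superlevel_def)

context
  fixes X :: "'a topology" and h :: "'a \<Rightarrow> ennreal"
  assumes open_superlevel: "\<And>t. openin X (superlevel X h t)"
begin

lemma valuation_superlevel_antimono:
  "continuous_valuation X \<mu> \<Longrightarrow> s \<le> t \<Longrightarrow> \<mu> (superlevel X h t) \<le> \<mu> (superlevel X h s)"
  by (rule continuous_valuation_mono[OF _ open_superlevel open_superlevel superlevel_antimono])

lemma measurable_valuation_superlevel [measurable]:
  "continuous_valuation X \<mu> \<Longrightarrow> (\<lambda>t. \<mu> (superlevel X h t)) \<in> borel_measurable borel"
  by (intro borel_measurable_antimono_ennreal valuation_superlevel_antimono)

lemma val_integral_mono:
  assumes "\<And>U. openin X U \<Longrightarrow> \<mu> U \<le> \<nu> U"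
  shows "val_integral X h \<mu> \<le> val_integral X h \<nu>"
  unfolding val_integral_superlevel
  by (intro nn_integral_mono mult_right_mono assms open_superlevel) simp

lemma val_integral_add:
  assumes "continuous_valuation X \<mu>" "continuous_valuation X \<nu>"
  shows "val_integral X h (val_add \<mu> \<nu>) = val_integral X h \<mu> + val_integral X h \<nu>"
  using assms unfolding val_integral_superlevel val_add_def
  by (simp add: distrib_right nn_integral_add)

text \<open>The integrand is antitone, so on \<open>{0..c}\<close> it is at least its value at
  \<open>c\<close>.\<close>

lemma Markov_val_integral:
  assumes \<mu>: "continuous_valuation X \<mu>" and c: "0 \<le> c"
  shows "ennreal c * \<mu> (superlevel X h c) \<le> val_integral X h \<mu>"
proof -
  have "ennreal c * \<mu> (superlevel X h c) = (\<integral>\<^sup>+ t. \<mu> (superlevel X h c) * indicator {0..c} t \<partial>lborel)"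
    using c by (subst nn_integral_cmult) (simp_all add: mult.commute)
  also have "\<dots> \<le> val_integral X h \<mu>"
    unfolding val_integral_superlevel
    by (intro nn_integral_mono)
      (auto simp: indicator_def intro: valuation_superlevel_antimono[OF \<mu>])
  finally show ?thesis .
qed

text \<open>Each term samples the antitone integrand at the left end of a cell of length
  \<open>\<epsilon>\<close>, the first cell starting at \<open>\<epsilon>\<close>. The sums thus
  bound the integral over \<open>{\<epsilon>..}\<close>, and monotone convergence along
  \<open>\<epsilon> = 1 / Suc n\<close> extends the bound to the whole half-line.\<close>

lemma val_integral_le_upper_sums:
  assumes \<mu>: "continuous_valuation X \<mu>"
    and sums: "\<And>\<epsilon> n. 0 < \<epsilon> \<Longrightarrow> (\<Sum>i<n. ennreal \<epsilon> * \<mu> (superlevel X h (real (Suc i) * \<epsilon>))) \<le> b"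
  shows "val_integral X h \<mu> \<le> b"
proof -
  define f where "f t = \<mu> (superlevel X h t)" for t
  have f_anti: "f t \<le> f s" if "s \<le> t" for s t
    unfolding f_def using that by (rule valuation_superlevel_antimono[OF \<mu>])
  have [measurable]: "f \<in> borel_measurable borel"
    unfolding f_def using \<mu> by measurable
  have tail: "(\<integral>\<^sup>+ t. f t * indicator {\<epsilon>..} t \<partial>lborel) \<le> b" if \<epsilon>: "0 < \<epsilon>" for \<epsilon>
  proof -
    let ?J = "\<lambda>i. {real (Suc i) * \<epsilon>..<real (Suc i) * \<epsilon> + \<epsilon>}"
    have "f t * indicator {\<epsilon>..} t \<le> (\<Sum>i. f (real (Suc i) * \<epsilon>) * indicator (?J i) t)" for t
    proof (cases "\<epsilon> \<le> t")
      case True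
      \<comment> \<open>The cell containing \<open>t\<close>; the subtraction is not truncated,
        because \<open>\<epsilon> \<le> t\<close> makes the floor at least 1.\<close>
      define i where "i = nat \<lfloor>t / \<epsilon>\<rfloor> - 1"
      have "1 \<le> \<lfloor>t / \<epsilon>\<rfloor>" using True \<epsilon> by (simp add: le_floor_iff)
      then have "real (Suc i) = of_int \<lfloor>t / \<epsilon>\<rfloor>" unfolding i_def by (simp add: of_nat_diff)
      then have "real (Suc i) \<le> t / \<epsilon>" "t / \<epsilon> < real (Suc i) + 1" by linarith+
      then have i: "real (Suc i) * \<epsilon> \<le> t" "t < real (Suc i) * \<epsilon> + \<epsilon>"
        using \<epsilon> by (simp_all add: field_simps)
      have "f t * indicator {\<epsilon>..} t \<le> f (real (Suc i) * \<epsilon>) * indicator (?J i) t"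
        using True i f_anti[OF i(1)] by (simp add: indicator_def)
      also have "\<dots> = (\<Sum>j\<in>{i}. f (real (Suc j) * \<epsilon>) * indicator (?J j) t)"
        by (simp only: sum.insert finite.emptyI empty_iff not_False_eq_True sum.empty add_0_right)
      also have "\<dots> \<le> (\<Sum>i. f (real (Suc i) * \<epsilon>) * indicator (?J i) t)"
        by (intro sum_le_suminf summableI) auto
      finally show ?thesis .
    qed simp
    then have "(\<integral>\<^sup>+ t. f t * indicator {\<epsilon>..} t \<partial>lborel)
        \<le> (\<integral>\<^sup>+ t. (\<Sum>i. f (real (Suc i) * \<epsilon>) * indicator (?J i) t) \<partial>lborel)"
      by (intro nn_integral_mono)
    also have "\<dots> = (\<Sum>i. ennreal \<epsilon> * f (real (Suc i) * \<epsilon>))"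
      using \<epsilon> by (simp add: nn_integral_suminf nn_integral_cmult mult.commute del: of_nat_Suc)
    also have "\<dots> \<le> b"
      using sums[OF \<epsilon>] by (intro suminf_le_const summableI) (simp add: f_def)
    finally show ?thesis .
  qed
  define g where "g n t = f t * indicator {1 / real (Suc n)..} t" for n t
  have "incseq g"
  proof (rule incseq_SucI)
    fix n
    have "1 / real (Suc (Suc n)) \<le> 1 / real (Suc n)" by (simp add: frac_le)
    then show "g n \<le> g (Suc n)"
      by (auto simp: le_fun_def g_def indicator_def)
  qed
  have SUP_g: "f t * indicator {0..} t \<le> (SUP n. g n t)" if "t \<noteq> 0" for t
  proof (cases "0 < t")
    case True
    then obtain n where "1 / real (Suc n) < t"
      using nat_approx_posE by blast
    then have "f t * indicator {0..} t = g n t"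
      using True by (simp add: g_def)
    then show ?thesis
      using SUP_upper[of n UNIV "\<lambda>n. g n t"] by simp
  qed (use that in simp)
  \<comment> \<open>Every \<open>g n\<close> vanishes at 0, where the integrand may be positive, so
    the pointwise comparison holds only off this null set.\<close>
  have "AE t in lborel. t \<noteq> (0::real)"
    by (rule AE_lborel_singleton)
  then have "val_integral X h \<mu> \<le> (\<integral>\<^sup>+ t. (SUP n. g n t) \<partial>lborel)"
    unfolding val_integral_superlevel f_def[symmetric]
    by (intro nn_integral_mono_AE) (auto elim!: eventually_mono intro: SUP_g)
  also have "\<dots> = (SUP n. \<integral>\<^sup>+ t. g n t \<partial>lborel)"
    by (rule nn_integral_monotone_convergence_SUP[OF \<open>incseq g\<close>]) (simp add: g_def[abs_def])
  also have "\<dots> \<le> b"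
    unfolding g_def by (intro SUP_least tail) simp
  finally show ?thesis .
qed

end

subsection \<open>Approximation by bounded valuations\<close>

lemma bounded_valuation_below:
  assumes \<mu>: "continuous_valuation X \<mu>" and "finite S"
    and S: "\<And>U r. (U, r) \<in> S \<Longrightarrow> openin X U \<and> 0 \<le> r \<and> ennreal r < \<mu> U"
  obtains \<nu> where "continuous_valuation X \<nu>" "\<nu> (topspace X) < \<infinity>" "\<And>U. \<nu> U \<le> \<mu> U"
    "\<And>U r. (U, r) \<in> S \<Longrightarrow> ennreal r < \<nu> U"
proof -
  text \<open>
    A multiple of \<open>\<delta>\<^sub>x\<close> stays below \<open>\<mu>\<close> if every neighbourhood of \<open>x\<close> has infinite mass;
    the remaining points lie in open sets of finite mass, to which \<open>\<mu>\<close> is restricted.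
  \<close>
  define K where "K F \<kappa> \<longleftrightarrow> openin X F \<and> \<mu> F < \<infinity> \<and> continuous_valuation X \<kappa> \<and>
      \<kappa> (topspace X) < \<infinity> \<and> (\<forall>U. \<kappa> U \<noteq> 0 \<longrightarrow> \<mu> U = \<infinity>)" for F \<kappa>
  have "\<exists>F \<kappa>. K F \<kappa> \<and> (\<forall>(U, r)\<in>S. ennreal r < \<mu> (F \<inter> U) + \<kappa> U)"
    using \<open>finite S\<close> S
  proof (induction S rule: finite_induct)
    case empty
    have "K {} (\<lambda>U. 0)"
      using \<mu> by (simp add: K_def continuous_valuation_zero continuous_valuation_empty[OF \<mu>])
    then show ?case by blast
  next
    case (insert p S)
    from insert.IH insert.prems obtain F \<kappa>
      where K: "K F \<kappa>" and IH: "\<forall>(U, r)\<in>S. ennreal r < \<mu> (F \<inter> U) + \<kappa> U"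
      by auto
    obtain U r where p: "p = (U, r)" by fastforce
    with insert.prems have U: "openin X U" "0 \<le> r" "ennreal r < \<mu> U" by auto
    \<comment> \<open>\<open>D\<close> is closed under binary unions. If it covers \<open>U\<close>,
      continuity of \<open>\<mu>\<close> yields a member of mass above \<open>r\<close>, which is
      joined to \<open>F\<close>; otherwise an uncovered point of \<open>U\<close> has only
      neighbourhoods of infinite mass.\<close>
    define D where "D = {G. openin X G \<and> G \<subseteq> U \<and> \<mu> G < \<infinity>}"
    show ?case
    proof (cases "U \<subseteq> \<Union>D")
      case True
      then have "\<Union>D = U" by (auto simp: D_def)
      moreover have "\<mu> (\<Union>D) = (SUP G\<in>D. \<mu> G)"
      proof (rule continuous_valuation_Union[OF \<mu>])
        show "D \<noteq> {}" using continuous_valuation_empty[OF \<mu>] by (auto simp: D_def)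
        fix G H assume "G \<in> D" "H \<in> D"
        then have "G \<union> H \<in> D"
          using continuous_valuation_Un_less_top[OF \<mu>] by (auto simp: D_def)
        then show "\<exists>W\<in>D. G \<subseteq> W \<and> H \<subseteq> W" by blast
      qed (simp add: D_def)
      ultimately obtain G where G: "G \<in> D" "ennreal r < \<mu> G"
        using U(3) by (auto simp: less_SUP_iff)
      have FG: "openin X (F \<union> G)" "\<mu> (F \<union> G) < \<infinity>"
        using K G continuous_valuation_Un_less_top[OF \<mu>, of F G] by (auto simp: K_def D_def)
      then have "K (F \<union> G) \<kappa>"
        using K by (simp add: K_def)
      moreover have "ennreal r < \<mu> ((F \<union> G) \<inter> U) + \<kappa> U"
      proof -
        have "\<mu> G \<le> \<mu> ((F \<union> G) \<inter> U)"
          using G FG U by (intro continuous_valuation_mono[OF \<mu>] openin_Int) (auto simp: D_def)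
        then show ?thesis using G(2) by (meson add_increasing2 less_le_trans zero_le)
      qed
      moreover have "ennreal r' < \<mu> ((F \<union> G) \<inter> U') + \<kappa> U'" if "(U', r') \<in> S" for U' r'
      proof -
        have "openin X U'" using that insert.prems by auto
        then have "\<mu> (F \<inter> U') \<le> \<mu> ((F \<union> G) \<inter> U')"
          using K FG by (intro continuous_valuation_mono[OF \<mu>] openin_Int) (auto simp: K_def)
        then show ?thesis using IH that by (auto intro: less_le_trans add_right_mono)
      qed
      ultimately show ?thesis unfolding p by blast
    next
      case False
      then obtain x where x: "x \<in> U" "x \<notin> \<Union>D" by blast
      \<comment> \<open>The coefficient \<open>r + 1\<close> makes the point mass alone meet the new
        constraint strictly. It charges only open sets containing \<open>x\<close>, all of infinite
        \<open>\<mu>\<close>-mass.\<close>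
      define \<kappa>' where "\<kappa>' = val_add \<kappa> (val_scale (r + 1) (dirac X x))"
      have "\<mu> V = \<infinity>" if "openin X V" "x \<in> V" for V
      proof (rule ccontr)
        assume "\<mu> V \<noteq> \<infinity>"
        moreover have "\<mu> (V \<inter> U) \<le> \<mu> V"
          using that U by (intro continuous_valuation_mono[OF \<mu>] openin_Int) auto
        ultimately have "V \<inter> U \<in> D"
          using that U by (auto simp: D_def openin_Int less_top[symmetric] top_unique)
        then show False using x that by blast
      qed
      moreover have "continuous_valuation X \<kappa>'"
        unfolding \<kappa>'_def using K
        by (intro continuous_valuation_add continuous_valuation_scale continuous_valuation_dirac)
          (simp add: K_def)
      ultimately have "K F \<kappa>'"
        using K by (auto simp: K_def \<kappa>'_def val_add_def val_scale_def dirac_def split: if_splits)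
      moreover have "\<kappa> V \<le> \<kappa>' V" for V
        by (simp add: \<kappa>'_def val_add_def)
      then have "\<forall>(U, r)\<in>S. ennreal r < \<mu> (F \<inter> U) + \<kappa>' U"
        using IH by (auto intro: less_le_trans add_left_mono)
      moreover have "ennreal r < \<mu> (F \<inter> U) + \<kappa>' U"
      proof -
        have "ennreal r < ennreal (r + 1)" using U by (simp add: ennreal_less_iff)
        also have "\<dots> \<le> \<mu> (F \<inter> U) + \<kappa>' U"
          using U x by (simp add: \<kappa>'_def val_add_def val_scale_def dirac_def add_increasing)
        finally show ?thesis .
      qed
      ultimately show ?thesis unfolding p by blast
    qed
  qed
  then obtain F \<kappa> where K: "K F \<kappa>" and FK: "\<forall>(U, r)\<in>S. ennreal r < \<mu> (F \<inter> U) + \<kappa> U"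
    by blast
  define \<nu> where "\<nu> = val_add (val_restrict X F \<mu>) \<kappa>"
  show thesis
  proof (rule that[of \<nu>])
    show \<nu>: "continuous_valuation X \<nu>"
      using K unfolding \<nu>_def K_def
      by (intro continuous_valuation_add continuous_valuation_restrict \<mu>) auto
    show "\<nu> (topspace X) < \<infinity>"
      using K by (simp add: \<nu>_def K_def val_add_def val_restrict_def openin_subset inf_absorb1)
    \<comment> \<open>Where \<open>\<kappa>\<close> vanishes, only
      \<open>\<mu> (F \<inter> U)\<close> remains; where it does not, \<open>\<mu> U\<close> is
      infinite.\<close>
    show "\<nu> U \<le> \<mu> U" for U
    proof (cases "openin X U \<and> \<kappa> U = 0")
      case True
      then show ?thesis
        using K by (simp add: \<nu>_def K_def val_add_def val_restrict_def
            continuous_valuation_mono[OF \<mu>] openin_Int)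
    next
      case False
      then show ?thesis
        using K continuous_valuation_nonopen[OF \<nu>] by (auto simp: K_def)
    qed
    show "ennreal r < \<nu> U" if "(U, r) \<in> S" for U r
      using that FK S by (fastforce simp: \<nu>_def val_add_def val_restrict_def)
  qed
qed

subsection \<open>Continuous linear functionals on spaces of valuations\<close>

locale continuous_linear_functional =
  fixes X :: "'a topology" and \<phi> :: "('a set \<Rightarrow> ennreal) \<Rightarrow> ennreal"
  assumes add: "\<And>\<mu> \<nu>. continuous_valuation X \<mu> \<Longrightarrow> continuous_valuation X \<nu> \<Longrightarrow>
      \<phi> (val_add \<mu> \<nu>) = \<phi> \<mu> + \<phi> \<nu>"
    and scale: "\<And>r \<mu>. 0 \<le> r \<Longrightarrow> continuous_valuation X \<mu> \<Longrightarrow> \<phi> (val_scale r \<mu>) = ennreal r * \<phi> \<mu>"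
    and lsc: "\<And>c. 0 \<le> c \<Longrightarrow> openin (Vw X) {\<mu>. continuous_valuation X \<mu> \<and> ennreal c < \<phi> \<mu>}"
begin

definition dirac_density :: "'a \<Rightarrow> ennreal" where
  "dirac_density x = \<phi> (dirac X x)"

lemma open_superlevel_dirac_density: "openin X (superlevel X dirac_density t)"
proof -
  \<comment> \<open>Lower semicontinuity speaks of nonnegative levels; \<open>ennreal\<close> sends
    a negative \<open>t\<close> to 0, so \<open>max 0 t\<close> describes the same set.\<close>
  have "openin X {x \<in> topspace X. dirac X x \<in> {\<mu>. continuous_valuation X \<mu> \<and> ennreal (max 0 t) < \<phi> \<mu>}}"
    by (rule openin_continuous_map_preimage[OF continuous_map_dirac lsc]) simp
  moreover have "ennreal (max 0 t) = ennreal t"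
    by (cases "0 \<le> t") (auto simp: max_def ennreal_neg)
  ultimately show ?thesis
    by (simp add: superlevel_def dirac_density_def continuous_valuation_dirac)
qed

text \<open>Each constraint defining a neighbourhood of the Dirac valuation has
  \<open>x \<in> U\<close> and \<open>r < 1\<close>. With \<open>V\<close> inside all these
  \<open>U\<close>, a valuation of mass at least \<open>t\<close> on \<open>V\<close> meets every
  constraint once divided by \<open>t\<close>, so homogeneity gives
  \<open>a * t \<le> \<phi> \<mu>\<close>.\<close>

lemma lower_bound_near:
  assumes a: "0 \<le> a" and x: "x \<in> topspace X" "ennreal a < dirac_density x"
  obtains V where "openin X V" "x \<in> V"
    "\<And>\<mu>. continuous_valuation X \<mu> \<Longrightarrow> ennreal a * \<mu> V \<le> \<phi> \<mu>"
proof -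
  obtain S where "finite S"
    and S: "\<And>U r. (U, r) \<in> S \<Longrightarrow> openin X U \<and> 0 \<le> r \<and> ennreal r < dirac X x U"
    and nbhd: "\<And>\<nu>. continuous_valuation X \<nu> \<Longrightarrow> (\<And>U r. (U, r) \<in> S \<Longrightarrow> ennreal r < \<nu> U) \<Longrightarrow>
      ennreal a < \<phi> \<nu>"
    by (rule Vw_neighbourhood[OF lsc[OF a], of "dirac X x"])
      (use x in \<open>auto simp: dirac_density_def continuous_valuation_dirac\<close>)
  have S1: "openin X U" "x \<in> U" "ennreal r < 1" if "(U, r) \<in> S" for U r
    using S[OF that] by (auto simp: dirac_def split: if_splits)
  \<comment> \<open>The whole space is included so that \<open>V\<close> is a finite intersection of
    opens of \<open>X\<close> even if \<open>S\<close> is empty.\<close>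
  define V where "V = \<Inter>(insert (topspace X) (fst ` S))"
  have "openin X V"
    unfolding V_def using \<open>finite S\<close> S1(1) by (intro openin_Inter) auto
  moreover have "x \<in> V"
    unfolding V_def using x(1) S1(2) by auto
  ultimately have V: "openin X V" "x \<in> V" .
  show thesis
  proof (rule that[OF V])
    fix \<mu> assume \<mu>: "continuous_valuation X \<mu>"
    \<comment> \<open>A finite positive \<open>t\<close> below \<open>\<mu> V\<close> is used for
      the division, since \<open>\<mu> V\<close> itself may be 0 or infinite.\<close>
    have bound: "ennreal (a * t) \<le> \<phi> \<mu>" if t: "0 < t" "ennreal t \<le> \<mu> V" for t
    proof -
      define \<nu> where "\<nu> = val_scale (1 / t) \<mu>"
      have "ennreal a < \<phi> \<nu>"
      proof (rule nbhd)
        show "continuous_valuation X \<nu>"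
          unfolding \<nu>_def by (rule continuous_valuation_scale[OF \<mu>])
        fix U r assume Ur: "(U, r) \<in> S"
        have "V \<subseteq> U" using Ur by (force simp: V_def)
        then have "ennreal t \<le> \<mu> U"
          using t(2) continuous_valuation_mono[OF \<mu> V(1)] S1[OF Ur] by (meson order_trans)
        then have "ennreal (1 / t) * ennreal t \<le> \<nu> U"
          unfolding \<nu>_def val_scale_def by (rule mult_left_mono) simp
        then have "1 \<le> \<nu> U"
          using t(1) by (simp flip: ennreal_mult)
        then show "ennreal r < \<nu> U"
          using S1[OF Ur] less_le_trans by blast
      qed
      then have "ennreal t * ennreal a \<le> ennreal t * (ennreal (1 / t) * \<phi> \<mu>)"
        using t(1) scale[OF _ \<mu>, of "1 / t"] by (intro mult_left_mono) (simp_all add: \<nu>_def)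
      also have "\<dots> = \<phi> \<mu>"
        using t(1) by (simp flip: mult.assoc ennreal_mult)
      finally show ?thesis
        using t(1) a by (simp add: ennreal_mult mult.commute)
    qed
    show "ennreal a * \<mu> V \<le> \<phi> \<mu>"
    proof (cases "\<mu> V")
      case (real m)
      then show ?thesis
        using bound[of m] a by (cases "m = 0") (simp_all flip: ennreal_mult)
    next
      case top
      show ?thesis
      proof (cases "a = 0")
        case False
        have all: "ennreal c \<le> \<phi> \<mu>" for c
        proof (cases "0 < c")
          case True
          then show ?thesis
            using bound[of "c / a"] False a top by simp
        qed (simp add: ennreal_neg)
        have "\<phi> \<mu> = top"
        proof (cases "\<phi> \<mu>")
          case (real b)
          then show ?thesis using all[of "b + 1"] by simp
        qed
        then show ?thesis by simp
      qed simp
    qed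
  qed
qed

lemma lower_bound_superlevel:
  assumes a: "0 \<le> a" and \<mu>: "continuous_valuation X \<mu>"
  shows "ennreal a * \<mu> (superlevel X dirac_density a) \<le> \<phi> \<mu>"
proof -
  \<comment> \<open>The bound is demanded for all valuations at once, so that for a union it can be
    applied to the two parts of \<open>\<mu>\<close> instead of \<open>\<mu>\<close>.\<close>
  define D where
    "D = {V. openin X V \<and> (\<forall>\<mu>. continuous_valuation X \<mu> \<longrightarrow> ennreal a * \<mu> V \<le> \<phi> \<mu>)}"
  have Un: "V \<union> W \<in> D" if VW: "V \<in> D" "W \<in> D" for V W
  proof -
    have "ennreal a * \<mu> (V \<union> W) \<le> \<phi> \<mu>" if \<mu>: "continuous_valuation X \<mu>" for \<mu>
    proof (cases "\<mu> V = \<infinity>")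
      case True
      moreover have "ennreal a * \<mu> V \<le> \<phi> \<mu>"
        using VW(1) \<mu> by (simp add: D_def)
      ultimately show ?thesis
        using a by (cases "a = 0") (simp_all add: ennreal_mult_top top_unique)
    next
      case False
      then have fin: "\<mu> V < \<infinity>" by (simp add: less_top)
      have V: "openin X V" and W: "openin X W" using VW by (simp_all add: D_def)
      \<comment> \<open>The mass of the union is that of \<open>V\<close> under the part on
        \<open>V\<close> plus that of \<open>W\<close> under the part off \<open>V\<close>.\<close>
      have "ennreal a * \<mu> (V \<union> W) = ennreal a * (\<mu> V + (\<mu> (W \<union> V) - \<mu> V))"
        using continuous_valuation_mono[OF \<mu> V, of "W \<union> V"] V W
        by (simp add: add_diff_self_ennreal Un_commute openin_Un)
      also have "\<dots> = ennreal a * val_restrict X V \<mu> V + ennreal a * val_corestrict X V \<mu> W"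
        using V W by (simp add: val_restrict_def val_corestrict_def distrib_left)
      also have "\<dots> \<le> \<phi> (val_restrict X V \<mu>) + \<phi> (val_corestrict X V \<mu>)"
        using VW continuous_valuation_restrict[OF \<mu> V] continuous_valuation_corestrict[OF \<mu> V fin]
        by (intro add_mono) (auto simp: D_def)
      also have "\<dots> = \<phi> \<mu>"
        by (simp add: add[symmetric] continuous_valuation_restrict[OF \<mu> V]
            continuous_valuation_corestrict[OF \<mu> V fin] val_add_restrict_corestrict[OF \<mu> V fin])
      finally show ?thesis .
    qed
    then show ?thesis using VW by (auto simp: D_def)
  qed
  have "superlevel X dirac_density a \<subseteq> \<Union>D"
  proof
    fix x assume "x \<in> superlevel X dirac_density a"
    then have "x \<in> topspace X" "ennreal a < dirac_density x" by (auto simp: superlevel_def)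
    from lower_bound_near[OF a this] show "x \<in> \<Union>D" unfolding D_def by blast
  qed
  then have "\<mu> (superlevel X dirac_density a) \<le> \<mu> (\<Union>D)"
    by (intro continuous_valuation_mono[OF \<mu>] open_superlevel_dirac_density) (auto simp: D_def)
  also have "\<dots> = (SUP V\<in>D. \<mu> V)"
  proof (rule continuous_valuation_Union[OF \<mu>])
    have "{} \<in> D"
      unfolding D_def using continuous_valuation_empty by fastforce
    then show "D \<noteq> {}" by blast
    show "\<exists>W\<in>D. U \<subseteq> W \<and> V \<subseteq> W" if "U \<in> D" "V \<in> D" for U V
      using Un[OF that] by blast
  qed (simp add: D_def)
  finally have "ennreal a * \<mu> (superlevel X dirac_density a) \<le> (SUP V\<in>D. ennreal a * \<mu> V)"
    unfolding SUP_mult_left_ennreal[symmetric] by (rule mult_left_mono) simp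
  also have "\<dots> \<le> \<phi> \<mu>"
    using \<mu> by (intro SUP_least) (simp add: D_def)
  finally show ?thesis .
qed

text \<open>Induction on the number of levels, for all valuations. The smallest set
  \<open>H n\<close> lies in all \<open>Suc n\<close> levels, so the part of \<open>\<mu>\<close> on
  it contributes \<open>Suc n * \<epsilon>\<close> times its mass, which
  \<open>lower_bound_superlevel\<close> controls; the part off it enters only the \<open>n\<close>
  lower levels, where the induction hypothesis applies.\<close>

lemma upper_sums_le:
  assumes \<epsilon>: "0 < \<epsilon>" and "continuous_valuation X \<mu>"
  shows "(\<Sum>i<n. ennreal \<epsilon> * \<mu> (superlevel X dirac_density (real (Suc i) * \<epsilon>))) \<le> \<phi> \<mu>"
  using assms(2)
proof (induction n arbitrary: \<mu>)
  case (Suc n)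
  define H where "H i = superlevel X dirac_density (real (Suc i) * \<epsilon>)" for i
  note \<mu> = \<open>continuous_valuation X \<mu>\<close>
  have H: "openin X (H i)" for i
    unfolding H_def by (rule open_superlevel_dirac_density)
  have low: "ennreal (real (Suc n) * \<epsilon>) * \<nu> (H n) \<le> \<phi> \<nu>" if "continuous_valuation X \<nu>" for \<nu>
    unfolding H_def using \<epsilon> that by (intro lower_bound_superlevel) simp_all
  show ?case
  proof (cases "\<mu> (H n) = \<infinity>")
    case True
    then have "\<phi> \<mu> = top"
      using low[OF \<mu>] \<epsilon> by (simp add: ennreal_mult_top top_unique del: of_nat_Suc)
    then show ?thesis by simp
  next
    case False
    then have fin: "\<mu> (H n) < \<infinity>" by (simp add: less_top)
    define \<mu>\<^sub>1 where "\<mu>\<^sub>1 = val_restrict X (H n) \<mu>"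
    define \<mu>\<^sub>2 where "\<mu>\<^sub>2 = val_corestrict X (H n) \<mu>"
    have cv: "continuous_valuation X \<mu>\<^sub>1" "continuous_valuation X \<mu>\<^sub>2"
      unfolding \<mu>\<^sub>1_def \<mu>\<^sub>2_def
      by (rule continuous_valuation_restrict[OF \<mu> H], rule continuous_valuation_corestrict[OF \<mu> H fin])
    have 1: "\<mu>\<^sub>1 (H n) = \<mu> (H n)"
      by (simp add: \<mu>\<^sub>1_def val_restrict_def H)
    have 2: "\<mu> (H i) = \<mu> (H n) + \<mu>\<^sub>2 (H i)" if "i < n" for i
    proof -
      have "H n \<subseteq> H i"
        unfolding H_def using that \<epsilon> by (intro superlevel_antimono mult_right_mono) simp_all
      then show ?thesis
        using continuous_valuation_mono[OF \<mu> H H, of n i]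
        by (simp add: \<mu>\<^sub>2_def val_corestrict_def H Un_absorb2 add_diff_self_ennreal)
    qed
    have "(\<Sum>i<Suc n. ennreal \<epsilon> * \<mu> (H i))
        = (\<Sum>i<n. ennreal \<epsilon> * \<mu> (H n)) + ennreal \<epsilon> * \<mu> (H n) + (\<Sum>i<n. ennreal \<epsilon> * \<mu>\<^sub>2 (H i))"
      by (simp add: 2 distrib_left sum.distrib add_ac)
    also have "(\<Sum>i<n. ennreal \<epsilon> * \<mu> (H n)) + ennreal \<epsilon> * \<mu> (H n) = (\<Sum>i<Suc n. ennreal \<epsilon> * \<mu> (H n))"
      by (simp only: sum.lessThan_Suc)
    also have "\<dots> = ennreal (real (Suc n) * \<epsilon>) * \<mu>\<^sub>1 (H n)"
      using \<epsilon> by (simp only: sum_constant card_lessThan 1) (simp add: ennreal_mult ennreal_of_nat_eq_real_of_nat mult.assoc del: of_nat_Suc)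
    also have "\<dots> + (\<Sum>i<n. ennreal \<epsilon> * \<mu>\<^sub>2 (H i)) \<le> \<phi> \<mu>\<^sub>1 + \<phi> \<mu>\<^sub>2"
      using low[OF cv(1)] Suc.IH[OF cv(2)] unfolding H_def by (rule add_mono)
    also have "\<dots> = \<phi> \<mu>"
      using add[OF cv] by (simp add: \<mu>\<^sub>1_def \<mu>\<^sub>2_def val_add_restrict_corestrict[OF \<mu> H fin])
    finally show ?thesis unfolding H_def .
  qed
qed simp

text \<open>
  The mass of \<open>\<mu>\<close> on each atom of the algebra generated by finitely many open sets is moved
  to a single point at which the density is nearly at most its average.
\<close>

lemma concentrate:
  assumes "finite \<U>" "\<And>U. U \<in> \<U> \<Longrightarrow> openin X U"
    and "continuous_valuation X \<mu>" "\<mu> (topspace X) < \<infinity>"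
    and "openin X V" "\<mu> V = \<mu> (topspace X)" "0 < \<epsilon>"
  shows "\<exists>\<theta>. continuous_valuation X \<theta> \<and> \<mu> V \<le> \<theta> V \<and> (\<forall>U\<in>\<U>. \<mu> U \<le> \<theta> U) \<and>
    \<phi> \<theta> \<le> val_integral X dirac_density \<mu> + ennreal \<epsilon>"
  using assms
proof (induction \<U> arbitrary: \<mu> V \<epsilon> rule: finite_induct)
  case empty
  note \<mu> = \<open>continuous_valuation X \<mu>\<close>
  \<comment> \<open>Vanishing mass and an infinite integral are split off because the average
    density \<open>I / m\<close> is formed next.\<close>
  consider "\<mu> V = 0" | "val_integral X dirac_density \<mu> = \<infinity>"
    | m I where "0 < m" "\<mu> V = ennreal m" "0 \<le> I" "val_integral X dirac_density \<mu> = ennreal I"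
  proof -
    have "\<mu> V < top" using empty.prems(3,5) by simp
    then obtain m where m: "0 \<le> m" "\<mu> V = ennreal m" by (meson less_top_ennreal)
    show thesis
    proof (cases "val_integral X dirac_density \<mu>")
      case (real I)
      with m that(1) that(3)[of m I] show thesis by (cases "m = 0") simp_all
    next
      case top
      with that(2) show thesis by simp
    qed
  qed
  then show ?case
  proof cases
    case 1
    have "\<phi> (val_scale 0 \<mu>) = 0" using scale[of 0 \<mu>] \<mu> by simp
    then show ?thesis
      using 1 continuous_valuation_scale[OF \<mu>] by (intro exI[of _ "val_scale 0 \<mu>"]) simp
  next
    case 2
    then show ?thesis using \<mu> by (intro exI[of _ \<mu>]) simp
  next
    case 3
    \<comment> \<open>Slightly above the average density: if the density exceeded \<open>c\<close>
      on all of \<open>V\<close>, the Markov bound would give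
      \<open>I + \<epsilon> \<le> I\<close>.\<close>
    define c where "c = (I + \<epsilon>) / m"
    have c: "0 \<le> c" "c * m = I + \<epsilon>" using 3 empty.prems by (simp_all add: c_def)
    have "\<exists>x\<in>V. dirac_density x \<le> ennreal c"
    proof (rule ccontr)
      assume "\<not> ?thesis"
      then have "V \<subseteq> superlevel X dirac_density c"
        using openin_subset[OF \<open>openin X V\<close>] by (auto simp: superlevel_def not_le)
      then have "\<mu> V \<le> \<mu> (superlevel X dirac_density c)"
        by (intro continuous_valuation_mono[OF \<mu>] open_superlevel_dirac_density empty.prems)
      then have "ennreal c * ennreal m \<le> ennreal c * \<mu> (superlevel X dirac_density c)"
        using 3 by (intro mult_left_mono) simp_all
      also have "\<dots> \<le> val_integral X dirac_density \<mu>"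
        by (rule Markov_val_integral[OF open_superlevel_dirac_density \<mu> c(1)])
      finally have "ennreal (I + \<epsilon>) \<le> ennreal I"
        using 3 c by (simp flip: ennreal_mult)
      then show False using 3 empty.prems by (simp add: ennreal_le_iff)
    qed
    then obtain x where x: "x \<in> V" "dirac_density x \<le> ennreal c" by blast
    show ?thesis
    proof (intro exI[of _ "val_scale m (dirac X x)"] conjI)
      show "continuous_valuation X (val_scale m (dirac X x))"
        by (intro continuous_valuation_scale continuous_valuation_dirac)
      show "\<mu> V \<le> val_scale m (dirac X x) V"
        using x empty.prems 3 by (simp add: val_scale_def dirac_def)
      have "\<phi> (val_scale m (dirac X x)) = ennreal m * dirac_density x"
        using 3 by (simp add: scale continuous_valuation_dirac dirac_density_def)
      also have "\<dots> \<le> ennreal m * ennreal c"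
        using x by (intro mult_left_mono) simp_all
      also have "\<dots> = val_integral X dirac_density \<mu> + ennreal \<epsilon>"
        using 3 c empty.prems by (simp add: mult.commute flip: ennreal_mult ennreal_plus)
      finally show "\<phi> (val_scale m (dirac X x)) \<le> val_integral X dirac_density \<mu> + ennreal \<epsilon>" .
    qed simp
  qed
next
  case (insert U \<U>)
  note \<mu> = \<open>continuous_valuation X \<mu>\<close>
  \<comment> \<open>The full-mass set is \<open>U \<inter> V\<close> for the part on
    \<open>U\<close> and \<open>V\<close> for the part off \<open>U\<close>. The hypothesis on full
    mass is what keeps the concentrated mass inside the chosen opens.\<close>
  have U: "openin X U" and V: "openin X V" using insert.prems by auto
  have "\<mu> U \<le> \<mu> (topspace X)"
    by (intro continuous_valuation_mono[OF \<mu> U] openin_topspace openin_subset[OF U])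
  then have fin: "\<mu> U < \<infinity>" using insert.prems by (meson le_less_trans)
  define \<mu>\<^sub>1 where "\<mu>\<^sub>1 = val_restrict X U \<mu>"
  define \<mu>\<^sub>2 where "\<mu>\<^sub>2 = val_corestrict X U \<mu>"
  have cv: "continuous_valuation X \<mu>\<^sub>1" "continuous_valuation X \<mu>\<^sub>2"
    unfolding \<mu>\<^sub>1_def \<mu>\<^sub>2_def
    by (rule continuous_valuation_restrict[OF \<mu> U], rule continuous_valuation_corestrict[OF \<mu> U fin])
  have split: "val_add \<mu>\<^sub>1 \<mu>\<^sub>2 = \<mu>"
    unfolding \<mu>\<^sub>1_def \<mu>\<^sub>2_def by (rule val_add_restrict_corestrict[OF \<mu> U fin])
  then have sum: "\<mu> W = \<mu>\<^sub>1 W + \<mu>\<^sub>2 W" for W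
    by (metis val_add_def)
  have top1: "\<mu>\<^sub>1 (topspace X) = \<mu> U"
    using openin_subset[OF U] by (simp add: \<mu>\<^sub>1_def val_restrict_def inf_absorb1)
  have UV: "\<mu> (U \<union> V) = \<mu> (topspace X)"
    using continuous_valuation_mono[OF \<mu> V, of "U \<union> V"] U V insert.prems(5)
      continuous_valuation_mono[OF \<mu>, of "U \<union> V" "topspace X"] openin_subset[of X]
    by (simp add: openin_Un order_antisym)
  have top2: "\<mu>\<^sub>2 V = \<mu>\<^sub>2 (topspace X)"
    using UV U V openin_subset[OF U] by (simp add: \<mu>\<^sub>2_def val_corestrict_def Un_commute sup_absorb2)
  \<comment> \<open>Both \<open>V\<close> and \<open>U \<union> V\<close> carry the whole finite
    mass, which cancels in the modular law.\<close>
  have "\<mu> (U \<inter> V) = \<mu> U"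
  proof -
    have "\<mu> (topspace X) + \<mu> (U \<inter> V) = \<mu> (topspace X) + \<mu> U"
      using continuous_valuation_modular[OF \<mu> U V] UV insert.prems(5) by (metis add.commute)
    then show ?thesis
      using insert.prems(3) by (metis ennreal_add_left_cancel less_irrefl)
  qed
  then have "\<mu>\<^sub>1 (U \<inter> V) = \<mu> U"
    using U V by (simp add: \<mu>\<^sub>1_def val_restrict_def openin_Int)
  with top1 have top1': "\<mu>\<^sub>1 (U \<inter> V) = \<mu>\<^sub>1 (topspace X)" by simp
  have "\<mu>\<^sub>1 (topspace X) < \<infinity>" "\<mu>\<^sub>2 (topspace X) < \<infinity>"
    using insert.prems(3) sum[of "topspace X"] by simp_all
  then obtain \<theta>\<^sub>1 \<theta>\<^sub>2 where
    \<theta>\<^sub>1: "continuous_valuation X \<theta>\<^sub>1" "\<mu>\<^sub>1 (U \<inter> V) \<le> \<theta>\<^sub>1 (U \<inter> V)" "\<forall>W\<in>\<U>. \<mu>\<^sub>1 W \<le> \<theta>\<^sub>1 W"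
      "\<phi> \<theta>\<^sub>1 \<le> val_integral X dirac_density \<mu>\<^sub>1 + ennreal (\<epsilon> / 2)" and
    \<theta>\<^sub>2: "continuous_valuation X \<theta>\<^sub>2" "\<mu>\<^sub>2 V \<le> \<theta>\<^sub>2 V" "\<forall>W\<in>\<U>. \<mu>\<^sub>2 W \<le> \<theta>\<^sub>2 W"
      "\<phi> \<theta>\<^sub>2 \<le> val_integral X dirac_density \<mu>\<^sub>2 + ennreal (\<epsilon> / 2)"
    using insert.IH[OF insert.prems(1)[OF insertI2] cv(1) _ openin_Int[OF U V] top1', of "\<epsilon> / 2"]
      insert.IH[OF insert.prems(1)[OF insertI2] cv(2) _ V top2, of "\<epsilon> / 2"]
      half_gt_zero[OF insert.prems(6)] by metis
  \<comment> \<open>The first part keeps mass at least \<open>\<mu> U\<close> inside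
    \<open>U \<inter> V\<close>, so it alone satisfies the constraint of the new set
    \<open>U\<close>.\<close>
  have \<theta>\<^sub>1': "\<mu> U \<le> \<theta>\<^sub>1 U" "\<mu> U \<le> \<theta>\<^sub>1 V"
  proof -
    have "\<theta>\<^sub>1 (U \<inter> V) \<le> \<theta>\<^sub>1 U" "\<theta>\<^sub>1 (U \<inter> V) \<le> \<theta>\<^sub>1 V"
      by (rule continuous_valuation_mono[OF \<theta>\<^sub>1(1)], auto intro: U V)+
    moreover have "\<mu> U \<le> \<theta>\<^sub>1 (U \<inter> V)"
      using \<theta>\<^sub>1(2) top1 top1' by simp
    ultimately show "\<mu> U \<le> \<theta>\<^sub>1 U" "\<mu> U \<le> \<theta>\<^sub>1 V" using order_trans by blast+
  qed
  have "\<mu>\<^sub>1 V \<le> \<mu> U"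
    using continuous_valuation_mono[OF cv(1) V openin_topspace openin_subset[OF V]] top1 by simp
  show ?case
  proof (intro exI[of _ "val_add \<theta>\<^sub>1 \<theta>\<^sub>2"] conjI ballI)
    show "continuous_valuation X (val_add \<theta>\<^sub>1 \<theta>\<^sub>2)"
      by (rule continuous_valuation_add[OF \<theta>\<^sub>1(1) \<theta>\<^sub>2(1)])
    show "\<mu> V \<le> val_add \<theta>\<^sub>1 \<theta>\<^sub>2 V"
      unfolding sum[of V] val_add_def
      by (rule add_mono[OF order_trans[OF \<open>\<mu>\<^sub>1 V \<le> \<mu> U\<close> \<theta>\<^sub>1'(2)] \<theta>\<^sub>2(2)])
    show "\<mu> W \<le> val_add \<theta>\<^sub>1 \<theta>\<^sub>2 W" if W: "W \<in> insert U \<U>" for W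
    proof (cases "W = U")
      case True
      then show ?thesis
        using \<theta>\<^sub>1' by (simp add: val_add_def add_increasing2)
    next
      case False
      then show ?thesis
        unfolding sum[of W] val_add_def using W \<theta>\<^sub>1(3) \<theta>\<^sub>2(3) by (intro add_mono) auto
    qed
    have "\<phi> (val_add \<theta>\<^sub>1 \<theta>\<^sub>2) \<le> (val_integral X dirac_density \<mu>\<^sub>1 + ennreal (\<epsilon> / 2))
        + (val_integral X dirac_density \<mu>\<^sub>2 + ennreal (\<epsilon> / 2))"
      unfolding add[OF \<theta>\<^sub>1(1) \<theta>\<^sub>2(1)] by (rule add_mono[OF \<theta>\<^sub>1(4) \<theta>\<^sub>2(4)])
    also have "\<dots> = val_integral X dirac_density (val_add \<mu>\<^sub>1 \<mu>\<^sub>2) + (ennreal (\<epsilon> / 2) + ennreal (\<epsilon> / 2))"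
      by (simp add: val_integral_add[OF open_superlevel_dirac_density cv] add_ac)
    also have "ennreal (\<epsilon> / 2) + ennreal (\<epsilon> / 2) = ennreal \<epsilon>"
      using insert.prems(6) by (simp flip: ennreal_plus)
    finally show "\<phi> (val_add \<theta>\<^sub>1 \<theta>\<^sub>2) \<le> val_integral X dirac_density \<mu> + ennreal \<epsilon>"
      unfolding split .
  qed
qed

text \<open>If the inequality failed, some \<open>c\<close> would lie strictly between, and
  \<open>\<phi>\<close> would exceed \<open>c\<close> on a weak neighbourhood of
  \<open>\<mu>\<close>. A bounded \<open>\<nu>\<close> below \<open>\<mu>\<close> still lies in it;
  concentrating \<open>\<nu>\<close> with slack \<open>c - I\<close>, where \<open>I\<close> is its
  integral, produces a point of the neighbourhood with value at most \<open>c\<close>.\<close>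

lemma functional_le_val_integral:
  assumes \<mu>: "continuous_valuation X \<mu>"
  shows "\<phi> \<mu> \<le> val_integral X dirac_density \<mu>"
proof (rule ccontr)
  assume "\<not> ?thesis"
  then obtain e where e: "val_integral X dirac_density \<mu> < e" "e < \<phi> \<mu>"
    using dense by (auto simp: not_le)
  from e(2) obtain c where c: "0 \<le> c" "e = ennreal c"
    by (cases e) auto
  obtain S where "finite S"
    and S: "\<And>U r. (U, r) \<in> S \<Longrightarrow> openin X U \<and> 0 \<le> r \<and> ennreal r < \<mu> U"
    and nbhd: "\<And>\<nu>. continuous_valuation X \<nu> \<Longrightarrow> (\<And>U r. (U, r) \<in> S \<Longrightarrow> ennreal r < \<nu> U) \<Longrightarrow>
      ennreal c < \<phi> \<nu>"
    by (rule Vw_neighbourhood[OF lsc[OF c(1)], of \<mu>]) (use e c \<mu> in auto)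
  obtain \<nu> where \<nu>: "continuous_valuation X \<nu>" "\<nu> (topspace X) < \<infinity>" "\<And>U. \<nu> U \<le> \<mu> U"
    "\<And>U r. (U, r) \<in> S \<Longrightarrow> ennreal r < \<nu> U"
    using bounded_valuation_below[OF \<mu> \<open>finite S\<close> S] by blast
  have "val_integral X dirac_density \<nu> < ennreal c"
    using val_integral_mono[OF open_superlevel_dirac_density \<nu>(3)] e(1) c(2) by (meson le_less_trans)
  then obtain I where I: "0 \<le> I" "val_integral X dirac_density \<nu> = ennreal I" "I < c"
    by (cases "val_integral X dirac_density \<nu>") (auto simp: ennreal_less_iff)
  have "finite (fst ` S)" "\<And>U. U \<in> fst ` S \<Longrightarrow> openin X U"
    using \<open>finite S\<close> S by auto
  from concentrate[OF this \<nu>(1,2) openin_topspace refl, of "c - I"] I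
  obtain \<theta> where \<theta>: "continuous_valuation X \<theta>" "\<forall>U\<in>fst ` S. \<nu> U \<le> \<theta> U"
    "\<phi> \<theta> \<le> ennreal I + ennreal (c - I)" by auto
  have "ennreal c < \<phi> \<theta>"
    using \<theta>(2) \<nu>(4) by (intro nbhd[OF \<theta>(1)]) (force intro: less_le_trans)
  also have "\<dots> \<le> ennreal c"
    using \<theta>(3) I by (simp flip: ennreal_plus)
  finally show False by simp
qed

theorem Schroeder_Simpson:
  assumes "continuous_valuation X \<mu>"
  shows "\<phi> \<mu> = val_integral X dirac_density \<mu>"
proof (rule order_antisym)
  show "\<phi> \<mu> \<le> val_integral X dirac_density \<mu>"
    by (rule functional_le_val_integral[OF assms])
  show "val_integral X dirac_density \<mu> \<le> \<phi> \<mu>"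
    using open_superlevel_dirac_density assms
    by (rule val_integral_le_upper_sums) (rule upper_sums_le[OF _ assms])
qed

end

subsection \<open>Algebras of the valuation monad\<close>

text \<open>The layer formula for a single value; it evaluates the monad multiplication on Dirac
  valuations.\<close>

lemma nn_integral_below_ennreal:
  "(\<integral>\<^sup>+ t. indicator {t. 0 \<le> t \<and> ennreal t < c} t \<partial>lborel) = c"
proof (cases c)
  case (real m)
  have "{t. 0 \<le> t \<and> ennreal t < c} = {0..<m}"
    using real by (auto simp: ennreal_less_iff)
  then show ?thesis using real by simp
next
  case top
  then have "{t. 0 \<le> t \<and> ennreal t < c} = {0..}" by auto
  moreover have "emeasure lborel {0::real..} = top"
  proof (cases "emeasure lborel {0::real..}")
    case (real b)
    have "ennreal (b + 1) = emeasure lborel {0..b + 1}"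
      using real by simp
    also have "\<dots> \<le> emeasure lborel {0::real..}"
      by (rule emeasure_mono) auto
    finally show ?thesis using real by simp
  qed
  ultimately show ?thesis using top by simp
qed

context
  fixes X :: "'a topology" and \<alpha> :: "('a set \<Rightarrow> ennreal) \<Rightarrow> 'a"
  assumes algebra: "Vw_algebra X \<alpha>"
begin

lemma continuous_map_structure: "continuous_map (Vw X) X \<alpha>"
  using algebra by (simp add: Vw_algebra_def)

lemma structure_closed: "continuous_valuation X \<mu> \<Longrightarrow> \<alpha> \<mu> \<in> topspace X"
  using continuous_map_structure by (auto simp: continuous_map_def Pi_iff)

lemma structure_dirac: "x \<in> topspace X \<Longrightarrow> \<alpha> (dirac X x) = x"
  using algebra by (simp add: Vw_algebra_def)

text \<open>The associativity law of the algebra at the valuation \<open>r \<delta>\<^sub>\<mu> + s \<delta>\<^sub>\<nu>\<close> on \<open>\<V>\<^sub>w X\<close>.\<close>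

lemma structure_combination:
  assumes \<mu>: "continuous_valuation X \<mu>" and \<nu>: "continuous_valuation X \<nu>"
    and r: "0 \<le> r" and s: "0 \<le> s"
  shows "\<alpha> (val_add (val_scale r \<mu>) (val_scale s \<nu>))
    = \<alpha> (val_add (val_scale r (dirac X (\<alpha> \<mu>))) (val_scale s (dirac X (\<alpha> \<nu>))))"
proof -
  define \<omega> where "\<omega> = val_add (val_scale r (dirac (Vw X) \<mu>)) (val_scale s (dirac (Vw X) \<nu>))"
  have "\<omega> \<in> topspace (Vw (Vw X))"
    unfolding \<omega>_def topspace_Vw mem_Collect_eq
    by (intro continuous_valuation_add continuous_valuation_scale continuous_valuation_dirac)
  then have "\<alpha> (Vw_mult X \<omega>) = \<alpha> (Vw_map (Vw X) X \<alpha> \<omega>)"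
    using algebra by (simp add: Vw_algebra_def)
  moreover have "Vw_mult X \<omega> = val_add (val_scale r \<mu>) (val_scale s \<nu>)"
  proof
    fix U
    show "Vw_mult X \<omega> U = val_add (val_scale r \<mu>) (val_scale s \<nu>) U"
    proof (cases "openin X U")
      case True
      have "val_integral (Vw X) (\<lambda>\<mu>. \<mu> U) \<omega>
          = (\<integral>\<^sup>+ t. ennreal r * indicator {t. 0 \<le> t \<and> ennreal t < \<mu> U} t
               + ennreal s * indicator {t. 0 \<le> t \<and> ennreal t < \<nu> U} t \<partial>lborel)"
        unfolding val_integral_def
      proof (rule nn_integral_cong)
        fix t :: real
        show "\<omega> {\<mu> \<in> topspace (Vw X). ennreal t < \<mu> U} * indicator {0..} t
            = ennreal r * indicator {t. 0 \<le> t \<and> ennreal t < \<mu> U} t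
               + ennreal s * indicator {t. 0 \<le> t \<and> ennreal t < \<nu> U} t"
          \<comment> \<open>For \<open>t \<ge> 0\<close> the level set is open, so the Dirac
            valuations do not take their default value 0; negative \<open>t\<close> are removed by
            the indicator.\<close>
          using openin_Vw_subbasic[OF True, of t] \<mu> \<nu>
          by (simp add: \<omega>_def val_add_def val_scale_def dirac_def indicator_def)
      qed
      also have "\<dots> = ennreal r * \<mu> U + ennreal s * \<nu> U"
        by (simp add: nn_integral_add nn_integral_cmult nn_integral_below_ennreal)
      finally show ?thesis
        using True by (simp add: Vw_mult_def val_add_def val_scale_def)
    next
      case False
      then show ?thesis
        by (simp add: Vw_mult_def val_add_def val_scale_def
            continuous_valuation_nonopen[OF \<mu>] continuous_valuation_nonopen[OF \<nu>])
    qed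
  qed
  moreover have "Vw_map (Vw X) X \<alpha> \<omega> = val_add (val_scale r (dirac X (\<alpha> \<mu>))) (val_scale s (dirac X (\<alpha> \<nu>)))"
  proof
    fix V
    have "openin (Vw X) {\<mu> \<in> topspace (Vw X). \<alpha> \<mu> \<in> V}" if "openin X V"
      using openin_continuous_map_preimage[OF continuous_map_structure that] .
    then show "Vw_map (Vw X) X \<alpha> \<omega> V
        = val_add (val_scale r (dirac X (\<alpha> \<mu>))) (val_scale s (dirac X (\<alpha> \<nu>))) V"
      using \<mu> \<nu> by (simp add: Vw_map_def \<omega>_def val_add_def val_scale_def dirac_def)
  qed
  ultimately show ?thesis by simp
qed

section \<open>Transport of the cone structure along the structure map\<close>

lemma structure_add:
  assumes "continuous_valuation X \<mu>" "continuous_valuation X \<nu>"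
  shows "\<alpha> (val_add \<mu> \<nu>) = alg_add X \<alpha> (\<alpha> \<mu>) (\<alpha> \<nu>)"
  using structure_combination[OF assms, of 1 1] by (simp add: alg_add_def val_scale_def)

lemma structure_scale:
  assumes "continuous_valuation X \<mu>" "0 \<le> r"
  shows "\<alpha> (val_scale r \<mu>) = alg_smul X \<alpha> r (\<alpha> \<mu>)"
  \<comment> \<open>The coefficient \<open>s = 0\<close> removes the second summand on both
    sides.\<close>
  using structure_combination[OF assms(1) assms(1) assms(2), of 0]
  by (simp add: alg_smul_def val_scale_def val_add_def)

text \<open>Each axiom holds pointwise for valuations and is carried over by
  \<open>\<alpha>\<close>, points being written as \<open>\<alpha>\<close> of their Dirac
  valuations. The neutral element is the image of the zero valuation.\<close>

lemma cone_on_algebra: "cone_on (topspace X) (alg_add X \<alpha>) (\<alpha> (\<lambda>U. 0)) (alg_smul X \<alpha>)"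
proof -
  note cv = continuous_valuation_add continuous_valuation_scale continuous_valuation_dirac
    continuous_valuation_zero
  let ?\<delta> = "dirac X"
  \<comment> \<open>Only one summand is a point here; this flattens the nested sums in the
    associative law.\<close>
  have pts: "alg_add X \<alpha> x (\<alpha> \<mu>) = \<alpha> (val_add (?\<delta> x) \<mu>)"
    "alg_add X \<alpha> (\<alpha> \<mu>) x = \<alpha> (val_add \<mu> (?\<delta> x))"
    if "x \<in> topspace X" "continuous_valuation X \<mu>" for x \<mu>
    using structure_add[of "?\<delta> x" \<mu>] structure_add[of \<mu> "?\<delta> x"] that
    by (simp_all add: cv structure_dirac)
  show ?thesis
  proof
    fix x y assume x: "x \<in> topspace X" and y: "y \<in> topspace X"
    show "alg_add X \<alpha> x y \<in> topspace X"
      unfolding alg_add_def by (intro structure_closed cv)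
    show "alg_add X \<alpha> x y = alg_add X \<alpha> y x"
      by (simp add: alg_add_def val_add_def add.commute)
    show "alg_add X \<alpha> (alg_add X \<alpha> x y) z = alg_add X \<alpha> x (alg_add X \<alpha> y z)" if z: "z \<in> topspace X" for z
      unfolding alg_add_def[of X \<alpha> x y] alg_add_def[of X \<alpha> y z]
      using x z by (simp add: pts cv) (simp add: val_add_def add.assoc)
    fix r :: real assume r: "0 \<le> r"
    have "alg_smul X \<alpha> r (alg_add X \<alpha> x y) = \<alpha> (val_scale r (val_add (?\<delta> x) (?\<delta> y)))"
      using r by (simp add: alg_add_def structure_scale cv)
    also have "\<dots> = \<alpha> (val_add (val_scale r (?\<delta> x)) (val_scale r (?\<delta> y)))"
      by (simp add: val_scale_def val_add_def distrib_left)
    also have "\<dots> = alg_add X \<alpha> (alg_smul X \<alpha> r x) (alg_smul X \<alpha> r y)"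
      by (simp add: structure_add cv alg_smul_def)
    finally show "alg_smul X \<alpha> r (alg_add X \<alpha> x y) = alg_add X \<alpha> (alg_smul X \<alpha> r x) (alg_smul X \<alpha> r y)" .
  next
    fix x assume x: "x \<in> topspace X"
    show "alg_add X \<alpha> x (\<alpha> (\<lambda>U. 0)) = x"
      using x by (simp add: pts cv) (simp add: val_add_def structure_dirac)
    show "alg_smul X \<alpha> 1 x = x" "alg_smul X \<alpha> 0 x = \<alpha> (\<lambda>U. 0)"
      using x by (simp_all add: alg_smul_def val_scale_def structure_dirac)
    fix r :: real assume r: "0 \<le> r"
    show "alg_smul X \<alpha> r x \<in> topspace X"
      unfolding alg_smul_def by (intro structure_closed cv)
    fix s :: real assume s: "0 \<le> s"
    have "alg_smul X \<alpha> (r + s) x = \<alpha> (val_add (val_scale r (?\<delta> x)) (val_scale s (?\<delta> x)))"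
      using r s by (simp add: alg_smul_def val_scale_def val_add_def distrib_right)
    then show "alg_smul X \<alpha> (r + s) x = alg_add X \<alpha> (alg_smul X \<alpha> r x) (alg_smul X \<alpha> s x)"
      by (simp add: structure_add cv alg_smul_def)
    have "alg_smul X \<alpha> (r * s) x = \<alpha> (val_scale r (val_scale s (?\<delta> x)))"
      using r s by (simp add: alg_smul_def val_scale_def ennreal_mult mult.assoc)
    then show "alg_smul X \<alpha> (r * s) x = alg_smul X \<alpha> r (alg_smul X \<alpha> s x)"
      using r by (simp add: structure_scale cv alg_smul_def[of X \<alpha> s])
  next
    fix r :: real assume "0 \<le> r"
    then have "alg_smul X \<alpha> r (\<alpha> (\<lambda>U. 0)) = \<alpha> (val_scale r (\<lambda>U. 0))"
      by (simp add: structure_scale cv)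
    then show "alg_smul X \<alpha> r (\<alpha> (\<lambda>U. 0)) = \<alpha> (\<lambda>U. 0)"
      by (simp add: val_scale_def)
  next
    show "\<alpha> (\<lambda>U. 0) \<in> topspace X"
      by (intro structure_closed cv)
  qed
qed

text \<open>Addition factors through \<open>Vw X\<close> as a sum of two Dirac valuations followed
  by \<open>\<alpha>\<close>. That sum takes only the values 0, 1 and 2 on an open \<open>U\<close>,
  so preimages of subbasic sets are built from open rectangles.\<close>

lemma continuous_map_alg_add: "continuous_map (prod_topology X X) X (\<lambda>(x, y). alg_add X \<alpha> x y)"
proof -
  have "continuous_map (prod_topology X X) (Vw X) (\<lambda>p. val_add (dirac X (fst p)) (dirac X (snd p)))"
  proof (rule continuous_map_Vw)
    fix U and r :: real assume U: "openin X U"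
    then have "U \<subseteq> topspace X" by (rule openin_subset)
    then have "{p \<in> topspace (prod_topology X X). ennreal r < val_add (dirac X (fst p)) (dirac X (snd p)) U}
        = (if ennreal r < 1 then U \<times> topspace X \<union> topspace X \<times> U
           else if ennreal r < 2 then U \<times> U else {})"
      using U by (auto simp: val_add_def dirac_def not_less intro: less_le_trans
          split: if_splits)
    then show "openin (prod_topology X X)
        {p \<in> topspace (prod_topology X X). ennreal r < val_add (dirac X (fst p)) (dirac X (snd p)) U}"
      using U by (simp add: openin_Un openin_prod_Times_iff)
  qed (intro continuous_valuation_add continuous_valuation_dirac)
  from continuous_map_compose[OF this continuous_map_structure] show ?thesis
    by (simp add: o_def alg_add_def case_prod_beta')
qed

text \<open>The map again factors through \<open>Vw X\<close>: a multiple of a Dirac valuation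
  exceeds \<open>s \<ge> 0\<close> on \<open>U\<close> exactly on the rectangle
  \<open>{s<..} \<times> U\<close>.\<close>

lemma continuous_map_alg_smul:
  "continuous_map (prod_topology scott_Rplus X) X (\<lambda>(r, x). alg_smul X \<alpha> r x)"
proof -
  have "continuous_map (prod_topology scott_Rplus X) (Vw X) (\<lambda>p. val_scale (fst p) (dirac X (snd p)))"
  proof (rule continuous_map_Vw)
    fix U and s :: real assume U: "openin X U" and s: "0 \<le> s"
    then have "{p \<in> topspace (prod_topology scott_Rplus X). ennreal s < val_scale (fst p) (dirac X (snd p)) U}
        = {s<..} \<times> U"
      using openin_subset[OF U] by (auto simp: val_scale_def dirac_def ennreal_less_iff split: if_splits)
    moreover have "openin scott_Rplus {s<..}"
      using s by (auto simp: openin_scott_Rplus)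
    ultimately show "openin (prod_topology scott_Rplus X)
        {p \<in> topspace (prod_topology scott_Rplus X). ennreal s < val_scale (fst p) (dirac X (snd p)) U}"
      using U by (simp add: openin_prod_Times_iff)
  qed (intro continuous_valuation_scale continuous_valuation_dirac)
  from continuous_map_compose[OF this continuous_map_structure] show ?thesis
    by (simp add: o_def alg_smul_def case_prod_beta')
qed

text \<open>The composite of \<open>\<Lambda>\<close> with \<open>\<alpha>\<close> is a continuous
  linear functional whose density is \<open>\<Lambda>\<close> by the unit law, so
  \<open>Schroeder_Simpson\<close> becomes the barycentre equation.\<close>

lemma structure_barycentre:
  assumes \<mu>: "continuous_valuation X \<mu>"
  shows "is_barycentre X (alg_add X \<alpha>) (alg_smul X \<alpha>) \<mu> (\<alpha> \<mu>)"
  unfolding is_barycentre_def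
proof (intro conjI allI impI)
  show "\<alpha> \<mu> \<in> topspace X" by (rule structure_closed[OF \<mu>])
  fix \<Lambda> assume "linear_between (topspace X) (alg_add X \<alpha>) (alg_smul X \<alpha>) UNIV (+) (\<lambda>r t. ennreal r * t) \<Lambda> \<and>
           continuous_map X scott_ennreal \<Lambda>"
  then have lin: "\<And>r s x y. 0 \<le> r \<Longrightarrow> 0 \<le> s \<Longrightarrow> x \<in> topspace X \<Longrightarrow> y \<in> topspace X \<Longrightarrow>
        \<Lambda> (alg_add X \<alpha> (alg_smul X \<alpha> r x) (alg_smul X \<alpha> s y)) = ennreal r * \<Lambda> x + ennreal s * \<Lambda> y"
    and cont: "continuous_map X scott_ennreal \<Lambda>"
    unfolding linear_between_def by blast+
  interpret cone: cone_on "topspace X" "alg_add X \<alpha>" "\<alpha> (\<lambda>U. 0)" "alg_smul X \<alpha>"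
    by (rule cone_on_algebra)
  interpret continuous_linear_functional X "\<lambda>\<mu>. \<Lambda> (\<alpha> \<mu>)"
  proof
    fix \<mu> \<nu> assume "continuous_valuation X \<mu>" "continuous_valuation X \<nu>"
    then show "\<Lambda> (\<alpha> (val_add \<mu> \<nu>)) = \<Lambda> (\<alpha> \<mu>) + \<Lambda> (\<alpha> \<nu>)"
      using lin[of 1 1 "\<alpha> \<mu>" "\<alpha> \<nu>"] by (simp add: structure_add structure_closed cone.one_smul)
  next
    fix r :: real and \<mu> assume "0 \<le> r" "continuous_valuation X \<mu>"
    then show "\<Lambda> (\<alpha> (val_scale r \<mu>)) = ennreal r * \<Lambda> (\<alpha> \<mu>)"
      using lin[of r 0 "\<alpha> \<mu>" "\<alpha> \<mu>"]
      by (simp add: structure_scale structure_closed cone.zero_smul cone.add_zero cone.smul_closed)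
  next
    fix c :: real assume "0 \<le> c"
    then have "openin scott_ennreal {t. ennreal c < t}"
      by (auto simp: openin_scott_ennreal)
    from openin_continuous_map_preimage[OF continuous_map_compose[OF continuous_map_structure cont] this]
    show "openin (Vw X) {\<mu>. continuous_valuation X \<mu> \<and> ennreal c < \<Lambda> (\<alpha> \<mu>)}"
      by simp
  qed
  \<comment> \<open>The unit law gives agreement only at points of \<open>X\<close>, so superlevel
    sets are compared instead of the functions.\<close>
  have "superlevel X dirac_density t = superlevel X \<Lambda> t" for t
    by (auto simp: superlevel_def dirac_density_def structure_dirac)
  then show "\<Lambda> (\<alpha> \<mu>) = val_integral X \<Lambda> \<mu>"
    using Schroeder_Simpson[OF \<mu>] by (simp add: val_integral_superlevel)
qed

end

theorem lemma4p6:
  fixes X :: "'a topology" and \<alpha> :: "('a set \<Rightarrow> ennreal) \<Rightarrow> 'a"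
  assumes "Vw_algebra X \<alpha>"
  shows "(\<exists>zero. topological_cone X (alg_add X \<alpha>) zero (alg_smul X \<alpha>)) \<and>
         linear_between (topspace (Vw X)) val_add val_scale
           (topspace X) (alg_add X \<alpha>) (alg_smul X \<alpha>) \<alpha> \<and>
         (\<forall>\<mu>\<in>topspace (Vw X). is_barycentre X (alg_add X \<alpha>) (alg_smul X \<alpha>) \<mu> (\<alpha> \<mu>))"
proof (intro conjI exI ballI)
  have "t0_space X" using assms by (simp add: Vw_algebra_def)
  then show "topological_cone X (alg_add X \<alpha>) (\<alpha> (\<lambda>U. 0)) (alg_smul X \<alpha>)"
    by (intro topological_cone.intro topological_cone_axioms.intro cone_on_algebra[OF assms]
        continuous_map_alg_add[OF assms] continuous_map_alg_smul[OF assms])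
  show "linear_between (topspace (Vw X)) val_add val_scale
           (topspace X) (alg_add X \<alpha>) (alg_smul X \<alpha>) \<alpha>"
    unfolding linear_between_def
    by (auto simp: structure_closed[OF assms] structure_add[OF assms] structure_scale[OF assms]
        continuous_valuation_scale)
  show "is_barycentre X (alg_add X \<alpha>) (alg_smul X \<alpha>) \<mu> (\<alpha> \<mu>)" if "\<mu> \<in> topspace (Vw X)" for \<mu>
    using that by (intro structure_barycentre[OF assms]) simp
qed

end
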